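(* Let $T>0$, let $\Omega\subset\mathbb R^d$ ($d\ge1$) be a bounded connected open set with smooth boundary, and let $F:\Omega\times[0,T]\times\mathbb R\to\mathbb R$ be globally Lipschitz in its last variable with constant $k$: $|F(x,t,w_1)-F(x,t,w_2)|\le k|w_1-w_2|$ for all $(x,t)\in\Omega\times[0,T]$, $w_1,w_2\in\mathbb R$. Let $p>0$, $\gamma\ge0$, $g\in H^{2\gamma}(\Omega)$. Assume that the problem $$u_t-\Delta u=F(x,t,u)\ \text{ in }\Omega\times(0,T),\qquad u|_{\partial\Omega}=0,\qquad u(\cdot,T)=g$$ has a unique solution $u$ such that, with a constant $A''$, $$\sum_{j=1}^\infty e^{2(t+r)\lambda_j}\langle u(\cdot,t),\phi_j\rangle^2<A'',\qquad t\in[0,T],$$ for any $r>0$. For $\delta>0$ let $N(\delta)\in\mathbb N$ with $N(\delta)\to\infty$ as $\delta\to0$, and let $\alpha_{N(\delta)}>0$ be chosen such that $$\lim_{\delta\to0}\alpha_{N(\delta)}=+\infty,\qquad\lim_{\delta\to0}\frac{e^{kT\alpha_{N(\delta)}}}{\lambda_{N(\delta)}^{\gamma}}=0,\qquad\lim_{\delta\to0}e^{kT\alpha_{N(\delta)}}\sqrt{N(\delta)}\,\delta=0.$$ Let $u^\delta_{N(\delta)}\in C([0,T];L^2(\Omega))$ be the unique solution of the regularized problem $$\partial_t u^\delta_{N(\delta)}-\Delta u^\delta_{N(\delta)}=\mathbf J_{\alpha_{N(\delta)}}F(x,t,u^\delta_{N(\delta)})\ \text{ in }\Omega\times(0,T),\quad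 u^\delta_{N(\delta)}|_{\partial\Omega}=0,\quad u^\delta_{N(\delta)}(\cdot,T)=\mathbf J_{\alpha_{N(\delta)}}\overline G_{\delta,N(\delta)}.$$ Then the following estimate holds: $$\mathbf E\|u^\delta_{N(\delta)}(\cdot,t)-u(\cdot,t)\|_{H^p(\Omega)}^2\le 2e^{2k^2T(T-t)}e^{-2t\alpha_{N(\delta)}}|\alpha_{N(\delta)}|^{p}\Big[2\delta^2N(\delta)e^{2T\alpha_{N(\delta)}}+2\frac{e^{2T\alpha_{N(\delta)}}}{\lambda_{N(\delta)}^{2\gamma}}\|g\|_{H^{2\gamma}(\Omega)}^2+A''e^{-2r\alpha_{N(\delta)}}\Big]+A''|\alpha_{N(\delta)}|^{p}e^{-2(t+r)\alpha_{N(\delta)}}.$$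
   Context: $(\lambda_j,\phi_j)_{j\ge1}$ are the eigenvalues ($0<\lambda_1\le\lambda_2\le\dots\to\infty$) and $L^2(\Omega)$-orthonormal eigenfunctions of $-\Delta$ on $\Omega$ with zero Dirichlet boundary condition; $\langle\cdot,\cdot\rangle$ is the $L^2(\Omega)$ inner product. For $p\ge0$, $\|v\|_{H^p(\Omega)}^2=\sum_j\lambda_j^p\langle v,\phi_j\rangle^2$, and $v\in H^p(\Omega)$ means this is finite. Noise model: $\xi$ is Gaussian white noise on $L^2(\Omega)$, so that $\xi_j=\langle\xi,\phi_j\rangle$ are i.i.d. standard normal random variables. One observes $\langle g_\delta^{\rm obs},\phi_j\rangle=\langle g,\phi_j\rangle+\delta\xi_j$ for $j=1,\dots,N(\delta)$, and sets $\overline G_{\delta,N(\delta)}=\sum_{j=1}^{N(\delta)}\langle g_\delta^{\rm obs},\phi_j\rangle\phi_j$. $\mathbf E$ is expectation with respect to this noise. For $\alpha>0$, $\mathbf J_\alpha v=\sum_{\lambda_j\le\alpha}\langle v,\phi_j\rangle\phi_j$ for $v\in L^2(\Omega)$. Solutions are understood in the mild sense: $u(\cdot,t)=\sum_{j}\big[e^{(T-t)\lambda_j}\langle g,\phi_j\rangle-\int_t^Te^{(s-t)\lambda_j}\langle F(\cdot,s,u(\cdot,s)),\phi_j\rangle\,ds\big]\phi_j$ and $u^\delta_{N(\delta)}(\cdot,t)=\sum_{\lambda_j\le\alpha_{N(\delta)}}\big[e^{(T-t)\lambda_j}\langle\overline G_{\delta,N(\delta)},\phi_j\rangle-\int_t^Te^{(s-t)\lambda_j}\langle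 F(\cdot,s,u^\delta_{N(\delta)}(\cdot,s)),\phi_j\rangle\,ds\big]\phi_j$.
   Formalization: The estimate is proved for all sufficiently small δ>0 uniformly in t∈[0,T], and for every δ>0 and t with p ≤ 2(t+r)α_{N(δ)}; for arbitrary δ>0 it fails (F=0, one-mode g, tiny α at a large δ). *)

theory Defs
  imports "HOL-Probability.Probability"
begin

section \<open>Domains with smooth boundary\<close>

text \<open>On an open set \<open>S\<close> this is the usual class \<open>C\<^sup>n\<close>: all directional derivatives of order less than
  \<open>n\<close> are differentiable and those of order \<open>n\<close> are continuous.\<close>

primrec Cn_on :: "nat \<Rightarrow> 'a::euclidean_space set \<Rightarrow> ('a \<Rightarrow> real) \<Rightarrow> bool" where
  "Cn_on 0 S f \<longleftrightarrow> continuous_on S f"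
| "Cn_on (Suc n) S f \<longleftrightarrow> (\<forall>x\<in>S. f differentiable (at x)) \<and>
     (\<forall>v. Cn_on n S (\<lambda>x. frechet_derivative f (at x) v))"

definition smooth_boundary :: "'a::euclidean_space set \<Rightarrow> bool" where
  "smooth_boundary \<Omega> \<longleftrightarrow>
     (\<forall>x\<^sub>0\<in>frontier \<Omega>. \<exists>U \<rho>. open U \<and> x\<^sub>0 \<in> U \<and> (\<forall>n. Cn_on n U \<rho>) \<and>
        (\<forall>x\<in>U. frechet_derivative \<rho> (at x) \<noteq> (\<lambda>v. 0)) \<and>
        \<Omega> \<inter> U = {x\<in>U. \<rho> x < 0} \<and> frontier \<Omega> \<inter> U = {x\<in>U. \<rho> x = 0})"

section \<open>The space \<open>L\<^sup>2(\<Omega>)\<close>\<close>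

definition L2 :: "'a::euclidean_space set \<Rightarrow> ('a \<Rightarrow> real) set" where
  "L2 \<Omega> = {f \<in> borel_measurable (lebesgue_on \<Omega>). integrable (lebesgue_on \<Omega>) (\<lambda>x. (f x)\<^sup>2)}"

definition L2_inner :: "'a::euclidean_space set \<Rightarrow> ('a \<Rightarrow> real) \<Rightarrow> ('a \<Rightarrow> real) \<Rightarrow> real" where
  "L2_inner \<Omega> f g = (LINT x|lebesgue_on \<Omega>. f x * g x)"

definition L2_norm :: "'a::euclidean_space set \<Rightarrow> ('a \<Rightarrow> real) \<Rightarrow> real" where
  "L2_norm \<Omega> f = sqrt (L2_inner \<Omega> f f)"

text \<open>Time-dependent functions are written with the time first: \<open>u t\<close> is \<open>u(\<cdot>,t)\<close>.\<close>

definition continuous_into_L2 :: "'a::euclidean_space set \<Rightarrow> real \<Rightarrow> (real \<Rightarrow> 'a \<Rightarrow> real) \<Rightarrow> bool" where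
  "continuous_into_L2 \<Omega> T u \<longleftrightarrow> (\<forall>t\<in>{0..T}. u t \<in> L2 \<Omega> \<and>
     ((\<lambda>s. L2_norm \<Omega> (\<lambda>x. u s x - u t x)) \<longlongrightarrow> 0) (at t within {0..T}))"

section \<open>Dirichlet eigenvalues and eigenfunctions\<close>

definition laplacian :: "('a::euclidean_space \<Rightarrow> real) \<Rightarrow> 'a \<Rightarrow> real" where
  "laplacian f x =
     (\<Sum>b\<in>Basis. frechet_derivative (\<lambda>y. frechet_derivative f (at y) b) (at x) b)"

definition dirichlet_eigenfunction ::
  "'a::euclidean_space set \<Rightarrow> real \<Rightarrow> ('a \<Rightarrow> real) \<Rightarrow> bool" where
  "dirichlet_eigenfunction \<Omega> \<mu> \<psi> \<longleftrightarrow>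
     continuous_on (closure \<Omega>) \<psi> \<and> Cn_on 2 \<Omega> \<psi> \<and> (\<exists>x\<in>\<Omega>. \<psi> x \<noteq> 0) \<and>
     (\<forall>x\<in>\<Omega>. - laplacian \<psi> x = \<mu> * \<psi> x) \<and> (\<forall>x\<in>frontier \<Omega>. \<psi> x = 0)"

text \<open>Sequences are indexed from 1; the values at index 0 are irrelevant.  The last conjunct says
  that all eigenvalues are listed, repeated according to multiplicity.  That the
  \<open>\<phi> j\<close> then form an orthonormal basis of \<open>L\<^sup>2(\<Omega>)\<close> is the spectral theorem.\<close>

definition dirichlet_eigensystem ::
  "'a::euclidean_space set \<Rightarrow> (nat \<Rightarrow> real) \<Rightarrow> (nat \<Rightarrow> 'a \<Rightarrow> real) \<Rightarrow> bool" where
  "dirichlet_eigensystem \<Omega> lam \<phi> \<longleftrightarrow>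
     0 < lam 1 \<and> (\<forall>i\<ge>1. \<forall>j\<ge>i. lam i \<le> lam j) \<and> filterlim lam at_top sequentially \<and>
     (\<forall>j\<ge>1. dirichlet_eigenfunction \<Omega> (lam j) (\<phi> j) \<and> \<phi> j \<in> L2 \<Omega>) \<and>
     (\<forall>i\<ge>1. \<forall>j\<ge>1. L2_inner \<Omega> (\<phi> i) (\<phi> j) = (if i = j then 1 else 0)) \<and>
     (\<forall>\<mu> \<psi>. dirichlet_eigenfunction \<Omega> \<mu> \<psi> \<longrightarrow>
        (\<exists>c. \<forall>x\<in>\<Omega>. \<psi> x = (\<Sum>j | 1 \<le> j \<and> lam j = \<mu>. c j * \<phi> j x)))"

definition Hp_norm_sq ::
  "'a::euclidean_space set \<Rightarrow> (nat \<Rightarrow> real) \<Rightarrow> (nat \<Rightarrow> 'a \<Rightarrow> real) \<Rightarrow> real \<Rightarrow> ('a \<Rightarrow> real) \<Rightarrow> ennreal" where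
  "Hp_norm_sq \<Omega> lam \<phi> p v =
     (\<Sum>j. ennreal (lam (Suc j) powr p * (L2_inner \<Omega> v (\<phi> (Suc j)))\<^sup>2))"

definition Hp_space ::
  "'a::euclidean_space set \<Rightarrow> (nat \<Rightarrow> real) \<Rightarrow> (nat \<Rightarrow> 'a \<Rightarrow> real) \<Rightarrow> real \<Rightarrow> ('a \<Rightarrow> real) set" where
  "Hp_space \<Omega> lam \<phi> p = {v \<in> L2 \<Omega>. Hp_norm_sq \<Omega> lam \<phi> p v < \<infinity>}"

section \<open>Mild solutions of the final value problems\<close>

text \<open>The \<open>j\<close>-th coefficient at time \<open>t\<close> in the mild formulation with final datum \<open>g\<close>.\<close>

definition mild_coeff ::
  "'a::euclidean_space set \<Rightarrow> (nat \<Rightarrow> real) \<Rightarrow> (nat \<Rightarrow> 'a \<Rightarrow> real) \<Rightarrow> real \<Rightarrow>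
   ('a \<Rightarrow> real \<Rightarrow> real \<Rightarrow> real) \<Rightarrow> ('a \<Rightarrow> real) \<Rightarrow> (real \<Rightarrow> 'a \<Rightarrow> real) \<Rightarrow> nat \<Rightarrow> real \<Rightarrow> real" where
  "mild_coeff \<Omega> lam \<phi> T F g u j t =
     exp ((T - t) * lam j) * L2_inner \<Omega> g (\<phi> j) -
     (LINT s|lebesgue_on {t..T}. exp ((s - t) * lam j) * L2_inner \<Omega> (\<lambda>x. F x s (u s x)) (\<phi> j))"

text \<open>Nothing but the Lipschitz condition is assumed of \<open>F\<close>, so that the integrals in the mild
  formulation make sense has to be part of the notion of solution (the Bochner integral of a
  non-integrable function is 0).\<close>

definition admissible_source ::
  "'a::euclidean_space set \<Rightarrow> (nat \<Rightarrow> 'a \<Rightarrow> real) \<Rightarrow> real \<Rightarrow>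
   ('a \<Rightarrow> real \<Rightarrow> real \<Rightarrow> real) \<Rightarrow> (real \<Rightarrow> 'a \<Rightarrow> real) \<Rightarrow> bool" where
  "admissible_source \<Omega> \<phi> T F u \<longleftrightarrow>
     (AE s in lebesgue_on {0..T}. (\<lambda>x. F x s (u s x)) \<in> L2 \<Omega>) \<and>
     (\<forall>j\<ge>1. integrable (lebesgue_on {0..T}) (\<lambda>s. L2_inner \<Omega> (\<lambda>x. F x s (u s x)) (\<phi> j)))"

definition mild_solution ::
  "'a::euclidean_space set \<Rightarrow> (nat \<Rightarrow> real) \<Rightarrow> (nat \<Rightarrow> 'a \<Rightarrow> real) \<Rightarrow> real \<Rightarrow>
   ('a \<Rightarrow> real \<Rightarrow> real \<Rightarrow> real) \<Rightarrow> ('a \<Rightarrow> real) \<Rightarrow> (real \<Rightarrow> 'a \<Rightarrow> real) \<Rightarrow> bool" where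
  "mild_solution \<Omega> lam \<phi> T F g u \<longleftrightarrow>
     continuous_into_L2 \<Omega> T u \<and> admissible_source \<Omega> \<phi> T F u \<and>
     (\<forall>t\<in>{0..T}. (\<lambda>n. L2_norm \<Omega> (\<lambda>x. u t x -
        (\<Sum>j=1..n. mild_coeff \<Omega> lam \<phi> T F g u j t * \<phi> j x))) \<longlonglongrightarrow> 0)"

definition regularized_mild_solution ::
  "'a::euclidean_space set \<Rightarrow> (nat \<Rightarrow> real) \<Rightarrow> (nat \<Rightarrow> 'a \<Rightarrow> real) \<Rightarrow> real \<Rightarrow>
   ('a \<Rightarrow> real \<Rightarrow> real \<Rightarrow> real) \<Rightarrow> real \<Rightarrow> ('a \<Rightarrow> real) \<Rightarrow> (real \<Rightarrow> 'a \<Rightarrow> real) \<Rightarrow> bool" where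
  "regularized_mild_solution \<Omega> lam \<phi> T F \<alpha> G v \<longleftrightarrow>
     continuous_into_L2 \<Omega> T v \<and> admissible_source \<Omega> \<phi> T F v \<and>
     (\<forall>t\<in>{0..T}. AE x in lebesgue_on \<Omega>. v t x =
        (\<Sum>j | 1 \<le> j \<and> lam j \<le> \<alpha>. mild_coeff \<Omega> lam \<phi> T F G v j t * \<phi> j x))"

definition unique_solution ::
  "'a::euclidean_space set \<Rightarrow> real \<Rightarrow> ((real \<Rightarrow> 'a \<Rightarrow> real) \<Rightarrow> bool) \<Rightarrow> (real \<Rightarrow> 'a \<Rightarrow> real) \<Rightarrow> bool" where
  "unique_solution \<Omega> T P u \<longleftrightarrow>
     P u \<and> (\<forall>v. P v \<longrightarrow> (\<forall>t\<in>{0..T}. AE x in lebesgue_on \<Omega>. v t x = u t x))"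

section \<open>Noisy data\<close>

text \<open>\<open>\<xi> j\<close> is the coefficient \<open>\<langle>\<xi>, \<phi> j\<rangle>\<close> of the white noise, the only way in which the noise enters
  the observation.\<close>

definition white_noise_coeffs :: "'w measure \<Rightarrow> (nat \<Rightarrow> 'w \<Rightarrow> real) \<Rightarrow> bool" where
  "white_noise_coeffs M \<xi> \<longleftrightarrow> prob_space M \<and>
     prob_space.indep_vars M (\<lambda>_. borel) \<xi> {1..} \<and>
     (\<forall>j\<ge>1. distributed M lborel (\<xi> j) std_normal_density)"

definition observed_data ::
  "'a::euclidean_space set \<Rightarrow> (nat \<Rightarrow> 'a \<Rightarrow> real) \<Rightarrow> (nat \<Rightarrow> 'w \<Rightarrow> real) \<Rightarrow> ('a \<Rightarrow> real) \<Rightarrow>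
   real \<Rightarrow> nat \<Rightarrow> 'w \<Rightarrow> 'a \<Rightarrow> real" where
  "observed_data \<Omega> \<phi> \<xi> g \<delta> N \<omega> x =
     (\<Sum>j=1..N. (L2_inner \<Omega> g (\<phi> j) + \<delta> * \<xi> j \<omega>) * \<phi> j x)"

end

theory Submission
  imports Defs
begin

text \<open>Let \<open>w = v - u\<close> be the error of a regularized solution \<open>v\<close> for one realisation of the noise.
  Multiplied by \<open>exp (2 t \<alpha>)\<close>, the part of \<open>\<parallel>w(t)\<parallel>\<^sup>2\<close> carried by the eigenvalues \<open>\<le> \<alpha>\<close> is bounded,
  by Cauchy--Schwarz in time, the Lipschitz condition and Bessel's inequality, by the weighted data
  error plus \<open>2 k\<^sup>2 T\<close> times the integral of the same weighted norm over \<open>[t, T]\<close>; the rest is a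
  coefficient tail of \<open>u\<close>, controlled by the exponential decay.  A backward Gronwall inequality bounds
  \<open>\<parallel>w(t)\<parallel>\<close>.  For the \<open>H\<^sup>p\<close> norm, low frequencies cost a factor \<open>\<alpha>\<^sup>p\<close>, and on the tail
  \<open>x\<^sup>p exp (- 2 (t + r) x)\<close> is decreasing for \<open>x \<ge> \<alpha>\<close> because \<open>p \<le> 2 (t + r) \<alpha>\<close>.  The pathwise bound
  is affine in the squares of the noise coefficients, so its expectation is explicit, whether or not
  the error is measurable in the noise.\<close>

section \<open>The inner product of \<open>L\<^sup>2(\<Omega>)\<close>\<close>

lemma L2_measurable: "f \<in> L2 \<Omega> \<Longrightarrow> f \<in> borel_measurable (lebesgue_on \<Omega>)"
  by (simp add: L2_def)

lemma L2_integrable_mult: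
  assumes "f \<in> L2 \<Omega>" "g \<in> L2 \<Omega>"
  shows "integrable (lebesgue_on \<Omega>) (\<lambda>x. f x * g x)"
proof (rule Bochner_Integration.integrable_bound)
  show "integrable (lebesgue_on \<Omega>) (\<lambda>x. (f x)\<^sup>2 + (g x)\<^sup>2)"
    using assms by (simp add: L2_def)
  show "(\<lambda>x. f x * g x) \<in> borel_measurable (lebesgue_on \<Omega>)"
    using assms by (intro borel_measurable_times L2_measurable)
  have "\<bar>a * b\<bar> \<le> a\<^sup>2 + b\<^sup>2" for a b :: real
  proof -
    have "0 \<le> (\<bar>a\<bar> - \<bar>b\<bar>)\<^sup>2" by simp
    then have "2 * \<bar>a * b\<bar> \<le> a\<^sup>2 + b\<^sup>2"
      by (simp add: power2_diff abs_mult)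
    then show ?thesis by linarith
  qed
  then show "AE x in lebesgue_on \<Omega>. norm (f x * g x) \<le> norm ((f x)\<^sup>2 + (g x)\<^sup>2)"
    by (auto intro!: AE_I2 order_trans[OF _ abs_ge_self])
qed

lemma L2_add: "f \<in> L2 \<Omega> \<Longrightarrow> g \<in> L2 \<Omega> \<Longrightarrow> (\<lambda>x. f x + g x) \<in> L2 \<Omega>"
  using L2_integrable_mult[of f \<Omega> g]
  by (auto simp: L2_def power2_sum mult.assoc)

lemma L2_cmult: "f \<in> L2 \<Omega> \<Longrightarrow> (\<lambda>x. c * f x) \<in> L2 \<Omega>"
  by (auto simp: L2_def power_mult_distrib)

lemma L2_diff: "f \<in> L2 \<Omega> \<Longrightarrow> g \<in> L2 \<Omega> \<Longrightarrow> (\<lambda>x. f x - g x) \<in> L2 \<Omega>"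
  using L2_add[of f \<Omega> "\<lambda>x. - 1 * g x"] L2_cmult[of g \<Omega> "- 1"] by simp

lemma L2_zero: "(\<lambda>x. 0) \<in> L2 \<Omega>"
  by (simp add: L2_def)

lemma L2_sum: "(\<And>j. j \<in> J \<Longrightarrow> f j \<in> L2 \<Omega>) \<Longrightarrow> (\<lambda>x. \<Sum>j\<in>J. f j x) \<in> L2 \<Omega>"
  by (induction J rule: infinite_finite_induct) (auto intro: L2_add L2_zero)

lemma L2_inner_commute: "L2_inner \<Omega> f g = L2_inner \<Omega> g f"
  by (simp add: L2_inner_def mult.commute)

lemma L2_inner_add_left:
  "f \<in> L2 \<Omega> \<Longrightarrow> g \<in> L2 \<Omega> \<Longrightarrow> h \<in> L2 \<Omega> \<Longrightarrow>
   L2_inner \<Omega> (\<lambda>x. f x + g x) h = L2_inner \<Omega> f h + L2_inner \<Omega> g h"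
  using L2_integrable_mult[of f \<Omega> h] L2_integrable_mult[of g \<Omega> h]
  by (simp add: L2_inner_def distrib_right)

lemma L2_inner_diff_left:
  "f \<in> L2 \<Omega> \<Longrightarrow> g \<in> L2 \<Omega> \<Longrightarrow> h \<in> L2 \<Omega> \<Longrightarrow>
   L2_inner \<Omega> (\<lambda>x. f x - g x) h = L2_inner \<Omega> f h - L2_inner \<Omega> g h"
  using L2_integrable_mult[of f \<Omega> h] L2_integrable_mult[of g \<Omega> h]
  by (simp add: L2_inner_def left_diff_distrib)

lemma L2_inner_add_right:
  "f \<in> L2 \<Omega> \<Longrightarrow> g \<in> L2 \<Omega> \<Longrightarrow> h \<in> L2 \<Omega> \<Longrightarrow>
   L2_inner \<Omega> h (\<lambda>x. f x + g x) = L2_inner \<Omega> h f + L2_inner \<Omega> h g"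
  using L2_inner_add_left[of f \<Omega> g h] by (simp add: L2_inner_commute)

lemma L2_inner_diff_right:
  "f \<in> L2 \<Omega> \<Longrightarrow> g \<in> L2 \<Omega> \<Longrightarrow> h \<in> L2 \<Omega> \<Longrightarrow>
   L2_inner \<Omega> h (\<lambda>x. f x - g x) = L2_inner \<Omega> h f - L2_inner \<Omega> h g"
  using L2_inner_diff_left[of f \<Omega> g h] by (simp add: L2_inner_commute)

lemma L2_inner_cmult_left: "L2_inner \<Omega> (\<lambda>x. c * f x) h = c * L2_inner \<Omega> f h"
  by (simp add: L2_inner_def mult.assoc)

lemma L2_inner_sum_left:
  assumes "\<And>j. j \<in> J \<Longrightarrow> f j \<in> L2 \<Omega>" "h \<in> L2 \<Omega>"
  shows "L2_inner \<Omega> (\<lambda>x. \<Sum>j\<in>J. f j x) h = (\<Sum>j\<in>J. L2_inner \<Omega> (f j) h)"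
  using assms(1)
proof (induction J rule: infinite_finite_induct)
  case (insert j J)
  then show ?case using assms(2) by (simp add: L2_inner_add_left L2_sum)
qed (simp_all add: L2_inner_def)

lemma L2_inner_cong_AE:
  assumes "AE x in lebesgue_on \<Omega>. f x = f' x" "f \<in> L2 \<Omega>" "f' \<in> L2 \<Omega>" "h \<in> L2 \<Omega>"
  shows "L2_inner \<Omega> f h = L2_inner \<Omega> f' h"
  unfolding L2_inner_def
  using assms by (intro integral_cong_AE borel_measurable_times L2_measurable) auto

lemma L2_inner_self_nonneg: "0 \<le> L2_inner \<Omega> f f"
  by (simp add: L2_inner_def)

lemma L2_norm_sq: "(L2_norm \<Omega> f)\<^sup>2 = L2_inner \<Omega> f f"
  by (simp add: L2_norm_def L2_inner_self_nonneg)

text \<open>Carries the pointwise Lipschitz bound over to norms. Squaring is legitimate for either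
  sign of \<open>k\<close>, because the smaller side is an absolute value.\<close>

lemma L2_inner_self_mono:
  assumes "f \<in> L2 \<Omega>" "g \<in> L2 \<Omega>" "\<And>x. x \<in> \<Omega> \<Longrightarrow> \<bar>f x\<bar> \<le> k * \<bar>g x\<bar>"
  shows "L2_inner \<Omega> f f \<le> k\<^sup>2 * L2_inner \<Omega> g g"
proof -
  have "L2_inner \<Omega> f f \<le> (LINT x|lebesgue_on \<Omega>. k\<^sup>2 * (g x * g x))"
    unfolding L2_inner_def
  proof (rule integral_mono)
    fix x assume "x \<in> space (lebesgue_on \<Omega>)"
    then have "x \<in> \<Omega>" by (simp add: space_restrict_space)
    then have "\<bar>f x\<bar>\<^sup>2 \<le> (k * \<bar>g x\<bar>)\<^sup>2" using assms(3) by (intro power_mono) auto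
    then show "f x * f x \<le> k\<^sup>2 * (g x * g x)"
      by (simp add: power_mult_distrib) (simp add: power2_eq_square mult_ac)
  qed (use assms L2_integrable_mult in auto)
  then show ?thesis by (simp add: L2_inner_def)
qed

text \<open>A real quadratic that never becomes negative has nonpositive discriminant. Both
  Cauchy-Schwarz inequalities below, in space and in time, come from this.\<close>

lemma square_le_of_quadratic_nonneg:
  fixes a b c :: real
  assumes "0 \<le> c" and "\<And>x. 0 \<le> a - 2 * x * b + x\<^sup>2 * c"
  shows "b\<^sup>2 \<le> a * c"
proof (cases "c = 0")
  case True
  have "b = 0"
  proof (rule ccontr)
    assume "b \<noteq> 0"
    \<comment> \<open>With \<open>c = 0\<close> the polynomial is affine in \<open>x\<close>, and
      this choice of \<open>x\<close> gives it the value -1.\<close>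
    then show False using assms(2)[of "(a + 1) / (2 * b)"] True by simp
  qed
  then show ?thesis using True by simp
next
  case False
  then have "c > 0" using assms(1) by simp
  \<comment> \<open>\<open>b / c\<close> is the minimiser of the quadratic; the factor
    \<open>c\<close> clears the denominator.\<close>
  then have "0 \<le> (a - 2 * (b / c) * b + (b / c)\<^sup>2 * c) * c"
    using assms(2)[of "b / c"] by simp
  also have "\<dots> = a * c - b\<^sup>2" using \<open>c > 0\<close> by (simp add: field_simps power2_eq_square)
  finally show ?thesis by simp
qed

text \<open>Elements of \<open>L2 \<Omega>\<close> are functions, not classes, so the form is only
  positive semidefinite. Its nonnegativity at \<open>f - c g\<close> for every real \<open>c\<close>
  suffices for the discriminant argument, degenerate \<open>g\<close> included.\<close>

lemma L2_Cauchy_Schwarz: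
  assumes "f \<in> L2 \<Omega>" "g \<in> L2 \<Omega>"
  shows "(L2_inner \<Omega> f g)\<^sup>2 \<le> L2_inner \<Omega> f f * L2_inner \<Omega> g g"
proof (rule square_le_of_quadratic_nonneg[OF L2_inner_self_nonneg])
  fix c :: real
  have "0 \<le> L2_inner \<Omega> (\<lambda>x. f x - c * g x) (\<lambda>x. f x - c * g x)"
    by (rule L2_inner_self_nonneg)
  also have "\<dots> = L2_inner \<Omega> f f - 2 * c * L2_inner \<Omega> f g + c\<^sup>2 * L2_inner \<Omega> g g"
    using assms
    by (simp add: L2_inner_diff_left L2_inner_diff_right L2_diff L2_cmult L2_inner_cmult_left
        L2_inner_commute[of \<Omega> _ "\<lambda>x. c * g x"] L2_inner_commute[of \<Omega> g f]
        algebra_simps power2_eq_square)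
  finally show "0 \<le> L2_inner \<Omega> f f - 2 * c * L2_inner \<Omega> f g + c\<^sup>2 * L2_inner \<Omega> g g" .
qed

section \<open>Orthonormal systems: coefficients, projections and Bessel's inequality\<close>

definition L2_orthonormal :: "'a::euclidean_space set \<Rightarrow> (nat \<Rightarrow> 'a \<Rightarrow> real) \<Rightarrow> bool" where
  "L2_orthonormal \<Omega> \<phi> \<longleftrightarrow> (\<forall>j\<ge>1. \<phi> j \<in> L2 \<Omega>) \<and>
     (\<forall>i\<ge>1. \<forall>j\<ge>1. L2_inner \<Omega> (\<phi> i) (\<phi> j) = (if i = j then 1 else 0))"

lemma L2_inner_orthonormal_sum:
  assumes "L2_orthonormal \<Omega> \<phi>" "J \<subseteq> {1..}" "finite J" "i \<ge> 1"
  shows "L2_inner \<Omega> (\<lambda>x. \<Sum>j\<in>J. c j * \<phi> j x) (\<phi> i) = (if i \<in> J then c i else 0)"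
proof -
  have "L2_inner \<Omega> (\<lambda>x. \<Sum>j\<in>J. c j * \<phi> j x) (\<phi> i) = (\<Sum>j\<in>J. c j * L2_inner \<Omega> (\<phi> j) (\<phi> i))"
    using assms by (subst L2_inner_sum_left)
      (auto simp: L2_orthonormal_def L2_inner_cmult_left intro!: L2_cmult)
  also have "\<dots> = (\<Sum>j\<in>J. if j = i then c j else 0)"
    using assms by (intro sum.cong) (auto simp: L2_orthonormal_def)
  finally show ?thesis using assms by (simp add: sum.delta)
qed

lemma L2_sum_orthonormal:
  assumes "L2_orthonormal \<Omega> \<phi>" "J \<subseteq> {1..}"
  shows "(\<lambda>x. \<Sum>j\<in>J. c j * \<phi> j x) \<in> L2 \<Omega>"
  using assms by (intro L2_sum L2_cmult) (auto simp: L2_orthonormal_def)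

text \<open>Pythagoras: the projection \<open>S\<close> of \<open>f\<close> has the same inner
  product with \<open>f\<close> as with itself, namely the sum of the squared coefficients, so
  expanding the square leaves that sum once with a minus sign. Bessel and Parseval both rest on this
  identity.\<close>

lemma L2_orthonormal_remainder:
  assumes on: "L2_orthonormal \<Omega> \<phi>" "J \<subseteq> {1..}" "finite J" and f: "f \<in> L2 \<Omega>"
  shows "L2_inner \<Omega> (\<lambda>x. f x - (\<Sum>j\<in>J. L2_inner \<Omega> f (\<phi> j) * \<phi> j x))
                    (\<lambda>x. f x - (\<Sum>j\<in>J. L2_inner \<Omega> f (\<phi> j) * \<phi> j x))
         = L2_inner \<Omega> f f - (\<Sum>j\<in>J. (L2_inner \<Omega> f (\<phi> j))\<^sup>2)"
proof -
  define S where "S = (\<lambda>x. \<Sum>j\<in>J. L2_inner \<Omega> f (\<phi> j) * \<phi> j x)"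
  have S: "S \<in> L2 \<Omega>" unfolding S_def by (rule L2_sum_orthonormal[OF on(1,2)])
  have *: "L2_inner \<Omega> S h = (\<Sum>j\<in>J. L2_inner \<Omega> f (\<phi> j) * L2_inner \<Omega> (\<phi> j) h)" if "h \<in> L2 \<Omega>" for h
    unfolding S_def using on that by (subst L2_inner_sum_left)
      (auto simp: L2_orthonormal_def L2_inner_cmult_left intro!: L2_cmult)
  have Sf: "L2_inner \<Omega> S f = (\<Sum>j\<in>J. (L2_inner \<Omega> f (\<phi> j))\<^sup>2)"
    using f by (subst *) (auto intro!: sum.cong simp: L2_inner_commute[of \<Omega> f] power2_eq_square)
  have "L2_inner \<Omega> (\<phi> j) S = L2_inner \<Omega> f (\<phi> j)" if "j \<in> J" for j
    using L2_inner_orthonormal_sum[OF on, of j "\<lambda>j. L2_inner \<Omega> f (\<phi> j)"] that on(2)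
    by (subst L2_inner_commute) (auto simp: S_def)
  then have SS: "L2_inner \<Omega> S S = (\<Sum>j\<in>J. (L2_inner \<Omega> f (\<phi> j))\<^sup>2)"
    using S by (simp add: * power2_eq_square)
  have "L2_inner \<Omega> (\<lambda>x. f x - S x) (\<lambda>x. f x - S x)
      = L2_inner \<Omega> f f - (\<Sum>j\<in>J. (L2_inner \<Omega> f (\<phi> j))\<^sup>2)"
    using f S Sf SS
    by (simp add: L2_inner_diff_left L2_inner_diff_right L2_diff L2_inner_commute[of \<Omega> f S])
  then show ?thesis by (simp add: S_def)
qed

lemma L2_Bessel:
  assumes "L2_orthonormal \<Omega> \<phi>" "J \<subseteq> {1..}" "finite J" "f \<in> L2 \<Omega>"
  shows "(\<Sum>j\<in>J. (L2_inner \<Omega> f (\<phi> j))\<^sup>2) \<le> L2_inner \<Omega> f f"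
proof -
  have "0 \<le> L2_inner \<Omega> f f - (\<Sum>j\<in>J. (L2_inner \<Omega> f (\<phi> j))\<^sup>2)"
    unfolding L2_orthonormal_remainder[OF assms, symmetric] by (rule L2_inner_self_nonneg)
  then show ?thesis by simp
qed

lemma L2_inner_tendsto_0:
  assumes "\<And>s. f s \<in> L2 \<Omega>" "h \<in> L2 \<Omega>" "((\<lambda>s. L2_norm \<Omega> (f s)) \<longlongrightarrow> 0) X"
  shows "((\<lambda>s. L2_inner \<Omega> (f s) h) \<longlongrightarrow> 0) X"
proof (rule Lim_null_comparison)
  show "\<forall>\<^sub>F s in X. norm (L2_inner \<Omega> (f s) h) \<le> L2_norm \<Omega> (f s) * L2_norm \<Omega> h"
  proof (rule always_eventually, rule allI)
    fix s
    have "sqrt ((L2_inner \<Omega> (f s) h)\<^sup>2) \<le> sqrt (L2_inner \<Omega> (f s) (f s) * L2_inner \<Omega> h h)"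
      by (rule real_sqrt_le_mono[OF L2_Cauchy_Schwarz[OF assms(1,2)]])
    then show "norm (L2_inner \<Omega> (f s) h) \<le> L2_norm \<Omega> (f s) * L2_norm \<Omega> h"
      by (simp add: L2_norm_def real_sqrt_mult)
  qed
  show "((\<lambda>s. L2_norm \<Omega> (f s) * L2_norm \<Omega> h) \<longlongrightarrow> 0) X"
    using tendsto_mult_right[OF assms(3), of "L2_norm \<Omega> h"] by simp
qed

text \<open>Taking a coefficient is continuous in norm by Cauchy-Schwarz, and the
  \<open>i\<close>-th coefficient of a partial sum stays at \<open>c i\<close> from
  \<open>n = i\<close> on. This turns the mild formulation, a statement about norm limits, into one
  equation per mode.\<close>

lemma L2_expansion_coeff:
  assumes on: "L2_orthonormal \<Omega> \<phi>" and f: "f \<in> L2 \<Omega>" and "i \<ge> 1"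
    and lim: "(\<lambda>n. L2_norm \<Omega> (\<lambda>x. f x - (\<Sum>j=1..n. c j * \<phi> j x))) \<longlonglongrightarrow> 0"
  shows "L2_inner \<Omega> f (\<phi> i) = c i"
proof -
  have phi: "\<phi> i \<in> L2 \<Omega>" using on \<open>i \<ge> 1\<close> by (simp add: L2_orthonormal_def)
  have S: "(\<lambda>x. \<Sum>j=1..n. c j * \<phi> j x) \<in> L2 \<Omega>" for n
    by (rule L2_sum_orthonormal[OF on]) auto
  have "(\<lambda>n. L2_inner \<Omega> (\<lambda>x. f x - (\<Sum>j=1..n. c j * \<phi> j x)) (\<phi> i)) \<longlonglongrightarrow> 0"
    by (rule L2_inner_tendsto_0[OF L2_diff[OF f S] phi lim])
  moreover have "\<forall>\<^sub>F n in sequentially.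
      L2_inner \<Omega> (\<lambda>x. f x - (\<Sum>j=1..n. c j * \<phi> j x)) (\<phi> i) = L2_inner \<Omega> f (\<phi> i) - c i"
    using eventually_ge_at_top[of i]
  proof eventually_elim
    case (elim n)
    then show ?case
      using L2_inner_orthonormal_sum[OF on, of "{1..n}" i c] \<open>i \<ge> 1\<close> f S phi
      by (auto simp: L2_inner_diff_left)
  qed
  ultimately have "(\<lambda>n::nat. L2_inner \<Omega> f (\<phi> i) - c i) \<longlonglongrightarrow> 0"
    by (simp cong: tendsto_cong)
  then show ?thesis by (simp add: LIMSEQ_const_iff)
qed

section \<open>Continuity in time of functions with values in \<open>L2 \<Omega>\<close>\<close>

text \<open>Follows from the nonnegativity of the squared norm of \<open>f + g\<close>. It does the
  work of the triangle inequality in the continuity proof that comes next.\<close>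

lemma L2_inner_self_diff_le:
  assumes "f \<in> L2 \<Omega>" "g \<in> L2 \<Omega>"
  shows "L2_inner \<Omega> (\<lambda>x. f x - g x) (\<lambda>x. f x - g x) \<le> 2 * L2_inner \<Omega> f f + 2 * L2_inner \<Omega> g g"
proof -
  have "0 \<le> L2_inner \<Omega> (\<lambda>x. f x + g x) (\<lambda>x. f x + g x)"
    by (rule L2_inner_self_nonneg)
  also have "\<dots> = L2_inner \<Omega> f f + 2 * L2_inner \<Omega> f g + L2_inner \<Omega> g g"
    using assms by (simp add: L2_inner_add_left L2_inner_add_right L2_add L2_inner_commute[of \<Omega> g f])
  finally show ?thesis
    using assms
    by (simp add: L2_inner_diff_left L2_inner_diff_right L2_diff L2_inner_commute[of \<Omega> g f])
qed

lemma continuous_into_L2_diff: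
  assumes u: "continuous_into_L2 \<Omega> T u" and v: "continuous_into_L2 \<Omega> T v"
  shows "continuous_into_L2 \<Omega> T (\<lambda>t x. u t x - v t x)"
  unfolding continuous_into_L2_def
proof (intro ballI conjI)
  fix t assume t: "t \<in> {0..T}"
  have mem: "u s \<in> L2 \<Omega>" "v s \<in> L2 \<Omega>" if "s \<in> {0..T}" for s
    using u v that by (auto simp: continuous_into_L2_def)
  show "(\<lambda>x. u t x - v t x) \<in> L2 \<Omega>"
    using mem t by (intro L2_diff)
  let ?a = "\<lambda>s x. u s x - u t x" and ?b = "\<lambda>s x. v s x - v t x"
  let ?c = "\<lambda>s x. u s x - v s x - (u t x - v t x)"
  have "((\<lambda>s. sqrt (2 * (L2_norm \<Omega> (?a s))\<^sup>2 + 2 * (L2_norm \<Omega> (?b s))\<^sup>2))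
      \<longlongrightarrow> sqrt (2 * 0\<^sup>2 + 2 * 0\<^sup>2)) (at t within {0..T})"
    using u v t by (intro tendsto_intros) (auto simp: continuous_into_L2_def)
  then have lim: "((\<lambda>s. sqrt (2 * (L2_norm \<Omega> (?a s))\<^sup>2 + 2 * (L2_norm \<Omega> (?b s))\<^sup>2))
      \<longlongrightarrow> 0) (at t within {0..T})" by simp
  show "((\<lambda>s. L2_norm \<Omega> (?c s)) \<longlongrightarrow> 0) (at t within {0..T})"
  proof (rule Lim_null_comparison[OF _ lim])
    have "norm (L2_norm \<Omega> (?c s)) \<le> sqrt (2 * (L2_norm \<Omega> (?a s))\<^sup>2 + 2 * (L2_norm \<Omega> (?b s))\<^sup>2)"
      if "s \<in> {0..T}" for s
    proof -
      have "L2_inner \<Omega> (?c s) (?c s) \<le> 2 * L2_inner \<Omega> (?a s) (?a s) + 2 * L2_inner \<Omega> (?b s) (?b s)"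
        using L2_inner_self_diff_le[OF L2_diff[OF mem(1)[OF that] mem(1)[OF t]]
            L2_diff[OF mem(2)[OF that] mem(2)[OF t]]]
        by (simp add: algebra_simps)
      then show ?thesis
        by (simp only: L2_norm_sq) (simp add: L2_norm_def L2_inner_self_nonneg)
    qed
    then show "\<forall>\<^sub>F s in at t within {0..T}. norm (L2_norm \<Omega> (?c s))
        \<le> sqrt (2 * (L2_norm \<Omega> (?a s))\<^sup>2 + 2 * (L2_norm \<Omega> (?b s))\<^sup>2)"
      by (auto simp: eventually_at_filter)
  qed
qed

text \<open>With \<open>d = w s - w t\<close>, the squared norms of \<open>w s\<close> and
  \<open>w t\<close> differ by that of \<open>d\<close> plus twice the inner product of
  \<open>d\<close> with \<open>w t\<close>, which Cauchy-Schwarz makes small. Gronwall's argument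
  needs this continuity to differentiate an integral of the squared norm.\<close>

lemma continuous_on_L2_inner_self:
  assumes w: "continuous_into_L2 \<Omega> T w"
  shows "continuous_on {0..T} (\<lambda>s. L2_inner \<Omega> (w s) (w s))"
  unfolding continuous_on_def
proof
  fix t assume t: "t \<in> {0..T}"
  have mem: "w s \<in> L2 \<Omega>" if "s \<in> {0..T}" for s
    using w that by (auto simp: continuous_into_L2_def)
  let ?n = "\<lambda>s. L2_norm \<Omega> (\<lambda>x. w s x - w t x)"
  have "((\<lambda>s. (?n s)\<^sup>2 + 2 * (?n s * L2_norm \<Omega> (w t))) \<longlongrightarrow> 0\<^sup>2 + 2 * (0 * L2_norm \<Omega> (w t)))
      (at t within {0..T})"
    using w t by (intro tendsto_intros) (auto simp: continuous_into_L2_def)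
  then have lim: "((\<lambda>s. (?n s)\<^sup>2 + 2 * (?n s * L2_norm \<Omega> (w t))) \<longlongrightarrow> 0) (at t within {0..T})"
    by simp
  have "((\<lambda>s. L2_inner \<Omega> (w s) (w s) - L2_inner \<Omega> (w t) (w t)) \<longlongrightarrow> 0) (at t within {0..T})"
  proof (rule Lim_null_comparison[OF _ lim])
    have "norm (L2_inner \<Omega> (w s) (w s) - L2_inner \<Omega> (w t) (w t)) \<le> (?n s)\<^sup>2 + 2 * (?n s * L2_norm \<Omega> (w t))"
      if "s \<in> {0..T}" for s
    proof -
      let ?d = "\<lambda>x. w s x - w t x"
      note m = mem[OF that] mem[OF t]
      have d: "?d \<in> L2 \<Omega>" using m by (rule L2_diff)
      have "L2_inner \<Omega> (w s) (w s) - L2_inner \<Omega> (w t) (w t)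
          = L2_inner \<Omega> ?d ?d + 2 * L2_inner \<Omega> ?d (w t)"
        using m d
        by (simp add: L2_inner_diff_left L2_inner_diff_right L2_inner_commute[of \<Omega> "w t" "w s"])
      moreover have "\<bar>L2_inner \<Omega> ?d (w t)\<bar> \<le> L2_norm \<Omega> ?d * L2_norm \<Omega> (w t)"
        using real_sqrt_le_mono[OF L2_Cauchy_Schwarz[OF d m(2)]]
        by (simp add: L2_norm_def real_sqrt_mult)
      moreover have "L2_inner \<Omega> ?d ?d = (L2_norm \<Omega> ?d)\<^sup>2" by (simp only: L2_norm_sq)
      moreover have "0 \<le> (L2_norm \<Omega> ?d)\<^sup>2" by simp
      ultimately show ?thesis unfolding real_norm_def by linarith
    qed
    then show "\<forall>\<^sub>F s in at t within {0..T}. norm (L2_inner \<Omega> (w s) (w s) - L2_inner \<Omega> (w t) (w t))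
        \<le> (?n s)\<^sup>2 + 2 * (?n s * L2_norm \<Omega> (w t))"
      by (auto simp: eventually_at_filter)
  qed
  then show "((\<lambda>s. L2_inner \<Omega> (w s) (w s)) \<longlongrightarrow> L2_inner \<Omega> (w t) (w t)) (at t within {0..T})"
    by (simp only: LIM_zero_iff)
qed

section \<open>Integral inequalities in time\<close>

text \<open>Cauchy-Schwarz against the constant 1, whose square has integral \<open>T - t\<close>.
  The nonnegative quadratic in \<open>x\<close> is the integral of the square of
  \<open>f s - x\<close>.\<close>

lemma integral_square_le:
  fixes f :: "real \<Rightarrow> real"
  assumes "t \<le> T" and f: "integrable (lebesgue_on {t..T}) f"
    and f2: "integrable (lebesgue_on {t..T}) (\<lambda>s. (f s)\<^sup>2)"
  shows "(LINT s|lebesgue_on {t..T}. f s)\<^sup>2 \<le> (LINT s|lebesgue_on {t..T}. (f s)\<^sup>2) * (T - t)"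
proof (rule square_le_of_quadratic_nonneg)
  fix x :: real
  have "0 \<le> (LINT s|lebesgue_on {t..T}. (f s - x)\<^sup>2)" by simp
  also have "\<dots> = (LINT s|lebesgue_on {t..T}. (f s)\<^sup>2 - 2 * x * f s + x\<^sup>2)"
    by (simp add: power2_diff algebra_simps)
  also have "\<dots> = (LINT s|lebesgue_on {t..T}. (f s)\<^sup>2) - 2 * x * (LINT s|lebesgue_on {t..T}. f s)
      + x\<^sup>2 * (T - t)"
    using f f2 \<open>t \<le> T\<close> by (simp add: measure_restrict_space)
  finally show "0 \<le> (LINT s|lebesgue_on {t..T}. (f s)\<^sup>2)
      - 2 * x * (LINT s|lebesgue_on {t..T}. f s) + x\<^sup>2 * (T - t)" .
qed (use assms(1) in simp)

text \<open>The right-hand side \<open>Z\<close> of the hypothesis has derivative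
  \<open>- K * Y \<ge> - K * Z\<close>, so \<open>exp (K * s) * Z s\<close> is nondecreasing in
  \<open>s\<close>. Comparison with the final time, where the integral vanishes and
  \<open>Z T = C\<close>, gives the bound.\<close>

lemma gronwall_backward:
  fixes Y :: "real \<Rightarrow> real"
  assumes cont: "continuous_on {0..T} Y" and "0 \<le> K" and t: "t \<in> {0..T}"
    and Y: "\<And>s. s \<in> {0..T} \<Longrightarrow> Y s \<le> C + K * integral {s..T} Y"
  shows "Y t \<le> C * exp (K * (T - t))"
proof -
  define Z where "Z = (\<lambda>s. C + K * integral {s..T} Y)"
  have Zder: "(Z has_real_derivative - K * Y s) (at s within {0..T})" if "s \<in> {0..T}" for s
    unfolding Z_def
    by (auto intro!: derivative_eq_intros integral_has_real_derivative'[OF cont that])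
  have der: "((\<lambda>s. exp (K * s) * Z s) has_real_derivative exp (K * s) * (K * (Z s - Y s)))
      (at s within {0..T})" if "s \<in> {0..T}" for s
    by (auto intro!: derivative_eq_intros Zder[OF that] simp: algebra_simps)
  have "exp (K * t) * Z t \<le> exp (K * T) * Z T"
  proof (rule DERIV_nonneg_imp_increasing_open[where f = "\<lambda>s. exp (K * s) * Z s"])
    fix s assume s: "t < s" "s < T"
    \<comment> \<open>The derivative found is relative to \<open>{0..T}\<close>. The monotonicity
      rule asks for a two-sided one in the open interval only; at the endpoints continuity is
      enough.\<close>
    have "at s within {0..T} = at s"
      using s t by (intro at_within_Icc_at) auto
    then have "((\<lambda>s. exp (K * s) * Z s) has_real_derivative exp (K * s) * (K * (Z s - Y s))) (at s)"
      using der[of s] s t by simp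
    moreover have "0 \<le> exp (K * s) * (K * (Z s - Y s))"
      using Y[of s] s t \<open>0 \<le> K\<close> by (simp add: Z_def)
    ultimately show "\<exists>y. ((\<lambda>s. exp (K * s) * Z s) has_real_derivative y) (at s) \<and> 0 \<le> y"
      by blast
  next
    have "continuous_on {0..T} (\<lambda>s. exp (K * s) * Z s)"
      by (rule DERIV_continuous_on[OF der])
    then show "continuous_on {t..T} (\<lambda>s. exp (K * s) * Z s)"
      by (rule continuous_on_subset) (use t in auto)
  qed (use t in auto)
  moreover have "Z T = C" by (simp add: Z_def)
  ultimately have "exp (K * t) * Z t \<le> exp (K * t) * (C * exp (K * (T - t)))"
    by (simp add: algebra_simps flip: exp_add)
  then have "Z t \<le> C * exp (K * (T - t))" by simp
  then show ?thesis using Y[OF t] by (simp add: Z_def)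
qed

section \<open>Eigenfunction coefficients of mild solutions\<close>

lemma dirichlet_eigensystem_orthonormal: "dirichlet_eigensystem \<Omega> lam \<phi> \<Longrightarrow> L2_orthonormal \<Omega> \<phi>"
  by (simp add: dirichlet_eigensystem_def L2_orthonormal_def)

text \<open>Holds because the eigenvalues tend to infinity. It ensures that the truncated expansions
  are genuine sums, since a sum over an infinite index set is 0 by convention.\<close>

lemma dirichlet_eigensystem_finite_le:
  assumes "dirichlet_eigensystem \<Omega> lam \<phi>"
  shows "finite {j. 1 \<le> j \<and> lam j \<le> \<alpha>}"
proof -
  have "\<forall>\<^sub>F j in sequentially. \<alpha> < lam j"
    using assms by (auto simp: dirichlet_eigensystem_def filterlim_at_top_dense)
  then obtain n where "\<And>j. j \<ge> n \<Longrightarrow> \<alpha> < lam j"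
    by (auto simp: eventually_sequentially)
  then have "{j. 1 \<le> j \<and> lam j \<le> \<alpha>} \<subseteq> {..<n}"
    by (force simp: not_le[symmetric])
  then show ?thesis by (rule finite_subset) simp
qed

lemma dirichlet_eigensystem_pos:
  assumes "dirichlet_eigensystem \<Omega> lam \<phi>" "j \<ge> 1"
  shows "0 < lam j"
  using assms by (force simp: dirichlet_eigensystem_def)

lemma mild_solution_coeff:
  assumes "L2_orthonormal \<Omega> \<phi>" "mild_solution \<Omega> lam \<phi> T F g u" "t \<in> {0..T}" "j \<ge> 1"
  shows "L2_inner \<Omega> (u t) (\<phi> j) = mild_coeff \<Omega> lam \<phi> T F g u j t"
  using assms
  by (intro L2_expansion_coeff[where c = "\<lambda>j. mild_coeff \<Omega> lam \<phi> T F g u j t"])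
    (auto simp: mild_solution_def continuous_into_L2_def)

text \<open>The finite expansion holds almost everywhere, which is enough for inner products. The
  vanishing above \<open>\<alpha>\<close> makes the high-frequency error that of \<open>u\<close>
  alone, up to sign.\<close>

lemma regularized_mild_solution_coeff:
  assumes on: "L2_orthonormal \<Omega> \<phi>" and v: "regularized_mild_solution \<Omega> lam \<phi> T F \<alpha> G v"
    and fin: "finite {j. 1 \<le> j \<and> lam j \<le> \<alpha>}" and t: "t \<in> {0..T}" and j: "j \<ge> 1"
  shows "L2_inner \<Omega> (v t) (\<phi> j) = (if lam j \<le> \<alpha> then mild_coeff \<Omega> lam \<phi> T F G v j t else 0)"
proof -
  let ?J = "{j. 1 \<le> j \<and> lam j \<le> \<alpha>}"
  have "L2_inner \<Omega> (v t) (\<phi> j)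
      = L2_inner \<Omega> (\<lambda>x. \<Sum>j\<in>?J. mild_coeff \<Omega> lam \<phi> T F G v j t * \<phi> j x) (\<phi> j)"
    using v t j on
    by (intro L2_inner_cong_AE L2_sum_orthonormal)
      (auto simp: regularized_mild_solution_def continuous_into_L2_def L2_orthonormal_def)
  also have "\<dots> = (if j \<in> ?J then mild_coeff \<Omega> lam \<phi> T F G v j t else 0)"
    using on fin j by (intro L2_inner_orthonormal_sum) auto
  finally show ?thesis using j by simp
qed

text \<open>This replaces completeness of the eigenfunctions: a mild solution is by definition the
  \<open>L\<^sup>2\<close> limit of its expansion.\<close>

lemma L2_Parseval_diff:
  assumes on: "L2_orthonormal \<Omega> \<phi>" and J: "finite J" "J \<subseteq> {1..}"
    and u: "u \<in> L2 \<Omega>" and v: "v \<in> L2 \<Omega>"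
    and v_eq: "AE x in lebesgue_on \<Omega>. v x = (\<Sum>j\<in>J. c j * \<phi> j x)"
    and lim: "(\<lambda>n. L2_norm \<Omega> (\<lambda>x. u x - (\<Sum>j=1..n. d j * \<phi> j x))) \<longlonglongrightarrow> 0"
  shows "(\<lambda>n. \<Sum>j=1..n. (L2_inner \<Omega> (\<lambda>x. v x - u x) (\<phi> j))\<^sup>2)
    \<longlonglongrightarrow> L2_inner \<Omega> (\<lambda>x. v x - u x) (\<lambda>x. v x - u x)"
proof -
  let ?w = "\<lambda>x. v x - u x"
  have w: "?w \<in> L2 \<Omega>" using u v by (intro L2_diff)
  have coeff: "L2_inner \<Omega> ?w (\<phi> j) = (if j \<in> J then c j else 0) - d j" if j: "j \<ge> 1" for j
  proof -
    have phi: "\<phi> j \<in> L2 \<Omega>" using on j by (simp add: L2_orthonormal_def)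
    have "L2_inner \<Omega> v (\<phi> j) = L2_inner \<Omega> (\<lambda>x. \<Sum>j\<in>J. c j * \<phi> j x) (\<phi> j)"
      by (rule L2_inner_cong_AE[OF v_eq v L2_sum_orthonormal[OF on J(2)] phi])
    then show ?thesis
      using L2_inner_orthonormal_sum[OF on J(2,1) j, of c] L2_expansion_coeff[OF on u j lim]
        L2_inner_diff_left[OF v u phi]
      by simp
  qed
  \<comment> \<open>Once \<open>{1..n}\<close> covers \<open>J\<close>, removing the partial
    expansion from \<open>v - u\<close> cancels \<open>v\<close> almost everywhere and leaves minus
    the truncation error of \<open>u\<close>. The sign is lost in the square, so the Parseval defect
    is exactly the quantity known to tend to 0.\<close>
  have rem: "L2_inner \<Omega> ?w ?w - (\<Sum>j=1..n. (L2_inner \<Omega> ?w (\<phi> j))\<^sup>2)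
      = (L2_norm \<Omega> (\<lambda>x. u x - (\<Sum>j=1..n. d j * \<phi> j x)))\<^sup>2" if n: "J \<subseteq> {1..n}" for n
  proof -
    let ?f = "\<lambda>x. ?w x - (\<Sum>j=1..n. L2_inner \<Omega> ?w (\<phi> j) * \<phi> j x)"
    let ?g = "\<lambda>x. u x - (\<Sum>j=1..n. d j * \<phi> j x)"
    have sub: "{1..n} \<subseteq> {1..}" by auto
    have f: "?f \<in> L2 \<Omega>" by (rule L2_diff[OF w L2_sum_orthonormal[OF on sub]])
    have g: "?g \<in> L2 \<Omega>" by (rule L2_diff[OF u L2_sum_orthonormal[OF on sub]])
    have sum_eq: "(\<Sum>j=1..n. L2_inner \<Omega> ?w (\<phi> j) * \<phi> j x)
        = (\<Sum>j\<in>J. c j * \<phi> j x) - (\<Sum>j=1..n. d j * \<phi> j x)" for x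
    proof -
      have "(\<Sum>j=1..n. L2_inner \<Omega> ?w (\<phi> j) * \<phi> j x)
          = (\<Sum>j=1..n. (if j \<in> J then c j * \<phi> j x else 0) - d j * \<phi> j x)"
        by (intro sum.cong) (auto simp: coeff left_diff_distrib)
      also have "(\<Sum>j=1..n. (if j \<in> J then c j * \<phi> j x else 0)) = (\<Sum>j\<in>J. c j * \<phi> j x)"
        using n by (simp add: sum.If_cases Int_absorb1)
      ultimately show ?thesis by (simp add: sum_subtractf)
    qed
    have "AE x in lebesgue_on \<Omega>. ?f x * ?f x = ?g x * ?g x"
      using v_eq by eventually_elim (simp only: sum_eq, simp add: algebra_simps)
    then have "L2_inner \<Omega> ?f ?f = L2_inner \<Omega> ?g ?g"
      unfolding L2_inner_def[of \<Omega> ?f ?f] L2_inner_def[of \<Omega> ?g ?g]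
      by (intro integral_cong_AE borel_measurable_times L2_measurable f g)
    then show ?thesis
      using L2_orthonormal_remainder[OF on sub _ w] by (simp add: L2_norm_sq)
  qed
  obtain m where m: "J \<subseteq> {..m}" using J(1) finite_nat_iff_bounded_le by blast
  have "(\<lambda>n. L2_inner \<Omega> ?w ?w - (L2_norm \<Omega> (\<lambda>x. u x - (\<Sum>j=1..n. d j * \<phi> j x)))\<^sup>2)
      \<longlonglongrightarrow> L2_inner \<Omega> ?w ?w - 0\<^sup>2"
    by (intro tendsto_intros lim)
  moreover have "\<forall>\<^sub>F n in sequentially. (\<Sum>j=1..n. (L2_inner \<Omega> ?w (\<phi> j))\<^sup>2)
      = L2_inner \<Omega> ?w ?w - (L2_norm \<Omega> (\<lambda>x. u x - (\<Sum>j=1..n. d j * \<phi> j x)))\<^sup>2"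
    using eventually_ge_at_top[of m]
  proof eventually_elim
    case (elim n)
    then have "J \<subseteq> {1..n}" using m J(2) by force
    from rem[OF this] show ?case by linarith
  qed
  ultimately show ?thesis by (simp add: tendsto_cong)
qed

section \<open>Tools for coefficient series, the observed data and the noise\<close>

text \<open>Links the series, shifted so as to start at index 1, with sums over finite sets of
  positive indices. Nonnegativity of \<open>A\<close> matters, because \<open>ennreal\<close> sends
  negative reals to 0.\<close>

lemma sum_le_of_ennreal_suminf:
  fixes a :: "nat \<Rightarrow> real"
  assumes "\<And>j. j \<ge> 1 \<Longrightarrow> 0 \<le> a j" "(\<Sum>j. ennreal (a (Suc j))) \<le> ennreal A" "0 \<le> A"
    "finite I" "I \<subseteq> {1..}"
  shows "sum a I \<le> A"
proof -
  let ?I = "(\<lambda>j. j - 1) ` I"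
  \<comment> \<open>Correct only because \<open>I\<close> omits 0: with truncated subtraction the
    index 0 would come back as 1.\<close>
  have I: "I = Suc ` ?I"
  proof -
    have "Suc (j - 1) = j" if "j \<in> I" for j using that assms(5) by auto
    then show ?thesis by (simp add: image_image)
  qed
  have "ennreal (sum a I) = (\<Sum>j\<in>I. ennreal (a j))"
    using assms by (subst sum_ennreal) auto
  also have "\<dots> = (\<Sum>j\<in>?I. ennreal (a (Suc j)))"
    by (subst I) (simp add: sum.reindex)
  also have "\<dots> \<le> (\<Sum>j. ennreal (a (Suc j)))"
    using assms(4) by (intro sum_le_suminf summableI) auto
  also note assms(2)
  finally show ?thesis using assms(3) by simp
qed

lemma observed_data_coeff:
  assumes "L2_orthonormal \<Omega> \<phi>" "j \<ge> 1"
  shows "L2_inner \<Omega> (observed_data \<Omega> \<phi> \<xi> g \<delta> N \<omega>) (\<phi> j)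
    = (if j \<le> N then L2_inner \<Omega> g (\<phi> j) + \<delta> * \<xi> j \<omega> else 0)"
  using L2_inner_orthonormal_sum[OF assms(1) _ _ assms(2), of "{1..N}"
      "\<lambda>j. L2_inner \<Omega> g (\<phi> j) + \<delta> * \<xi> j \<omega>"] assms(2)
  by (auto simp: observed_data_def[abs_def])

lemma white_noise_second_moment:
  assumes "white_noise_coeffs M \<xi>" "j \<ge> 1"
  shows "(\<integral>\<^sup>+\<omega>. ennreal ((\<xi> j \<omega>)\<^sup>2) \<partial>M) = 1"
proof -
  have d: "distributed M lborel (\<xi> j) std_normal_density"
    using assms by (simp add: white_noise_coeffs_def)
  have "(\<integral>\<^sup>+\<omega>. ennreal ((\<xi> j \<omega>)\<^sup>2) \<partial>M) = (\<integral>\<^sup>+x. ennreal (std_normal_density x) * ennreal (x\<^sup>2) \<partial>lborel)"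
    by (rule distributed_nn_integral[OF d, symmetric]) simp
  also have "\<dots> = (\<integral>\<^sup>+x. ennreal (std_normal_density x * x ^ (2 * 1)) \<partial>lborel)"
    by (simp add: ennreal_mult)
  also have "\<dots> = ennreal (integral\<^sup>L lborel (\<lambda>x. std_normal_density x * x ^ (2 * 1)))"
    using std_normal_moment_even[of 1]
    by (intro nn_integral_eq_integral) (auto intro: integrable.intros)
  \<comment> \<open>The moment of order \<open>2 * k\<close> is
    \<open>fact (2 * k) / (2 ^ k * fact k)\<close>, which is 1 for \<open>k = 1\<close>.\<close>
  also have "\<dots> = 1" by (subst integral_std_normal_moment_even) (simp add: fact_numeral)
  finally show ?thesis .
qed

lemma white_noise_measurable:
  assumes "white_noise_coeffs M \<xi>" "j \<ge> 1"
  shows "\<xi> j \<in> borel_measurable M"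
proof -
  have "distributed M lborel (\<xi> j) std_normal_density"
    using assms by (simp add: white_noise_coeffs_def)
  from distributed_measurable[OF this] show ?thesis by simp
qed

section \<open>The error of the regularized solution\<close>

text \<open>Bessel is applied to the difference of the sources as a whole, and the Lipschitz bound
  only afterwards. The constant is therefore independent of the number of modes in
  \<open>J\<close>.\<close>

lemma source_difference_Bessel:
  assumes on: "L2_orthonormal \<Omega> \<phi>" and J: "finite J" "J \<subseteq> {1..}"
    and "f \<in> L2 \<Omega>" "f' \<in> L2 \<Omega>" "u \<in> L2 \<Omega>" "v \<in> L2 \<Omega>"
    and "\<And>x. x \<in> \<Omega> \<Longrightarrow> \<bar>f x - f' x\<bar> \<le> k * \<bar>v x - u x\<bar>"
  shows "(\<Sum>j\<in>J. (L2_inner \<Omega> f (\<phi> j) - L2_inner \<Omega> f' (\<phi> j))\<^sup>2)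
    \<le> k\<^sup>2 * L2_inner \<Omega> (\<lambda>x. v x - u x) (\<lambda>x. v x - u x)"
proof -
  have "(\<Sum>j\<in>J. (L2_inner \<Omega> f (\<phi> j) - L2_inner \<Omega> f' (\<phi> j))\<^sup>2)
      = (\<Sum>j\<in>J. (L2_inner \<Omega> (\<lambda>x. f x - f' x) (\<phi> j))\<^sup>2)"
    using assms by (intro sum.cong refl) (subst L2_inner_diff_left, auto simp: L2_orthonormal_def)
  also have "\<dots> \<le> L2_inner \<Omega> (\<lambda>x. f x - f' x) (\<lambda>x. f x - f' x)"
    using assms by (intro L2_Bessel L2_diff)
  also have "\<dots> \<le> k\<^sup>2 * L2_inner \<Omega> (\<lambda>x. v x - u x) (\<lambda>x. v x - u x)"
    using assms by (intro L2_inner_self_mono L2_diff)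
  finally show ?thesis .
qed

text \<open>For \<open>s \<ge> t\<close> and \<open>lam j \<le> \<alpha>\<close>, the kernel
  \<open>exp ((s - t) * lam j)\<close> times \<open>exp (t * \<alpha>)\<close> is at most
  \<open>exp (s * \<alpha>)\<close>, a weight common to all modes. Cauchy-Schwarz in time then works
  mode by mode, and the factor \<open>T\<close> is a bound for \<open>T - t\<close>.\<close>

lemma weighted_integral_square_le:
  fixes W :: "nat \<Rightarrow> real \<Rightarrow> real" and B :: "real \<Rightarrow> real"
  assumes t: "t \<in> {0..T}" and J: "finite J" "\<And>j. j \<in> J \<Longrightarrow> lam j \<le> \<alpha>"
    and W: "\<And>j. j \<in> J \<Longrightarrow> integrable (lebesgue_on {t..T}) (W j)"
    and B: "continuous_on {t..T} B"
    and WB: "AE s in lebesgue_on {t..T}. (\<Sum>j\<in>J. (W j s)\<^sup>2) \<le> B s"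
  shows "exp (2 * t * \<alpha>) * (\<Sum>j\<in>J. (LINT s|lebesgue_on {t..T}. exp ((s - t) * lam j) * W j s)\<^sup>2)
    \<le> T * (LINT s|lebesgue_on {t..T}. exp (2 * s * \<alpha>) * B s)"
proof -
  let ?M = "lebesgue_on {t..T}"
  define h where "h = (\<lambda>j s. exp (t * \<alpha>) * (exp ((s - t) * lam j) * W j s))"
  let ?B = "\<lambda>s. exp (2 * s * \<alpha>) * B s"
  have Bint: "integrable ?M ?B"
    by (intro continuous_imp_integrable_real continuous_intros B)
  have spM: "space ?M = {t..T}" by (simp add: space_restrict_space)
  have hmeas: "h j \<in> borel_measurable ?M" if "j \<in> J" for j
  proof -
    have "(\<lambda>s. exp ((s - t) * lam j)) \<in> borel_measurable ?M"
      by (intro continuous_imp_measurable_on_sets_lebesgue continuous_intros) auto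
    then show ?thesis unfolding h_def
      using W[OF that] by (intro borel_measurable_times borel_measurable_const) auto
  qed
  have hle: "\<bar>h j s\<bar> \<le> exp (s * \<alpha>) * \<bar>W j s\<bar>" if "j \<in> J" "s \<in> {t..T}" for j s
  proof -
    have "(s - t) * lam j \<le> (s - t) * \<alpha>"
      using that J by (intro mult_left_mono) auto
    then have "exp (t * \<alpha>) * exp ((s - t) * lam j) \<le> exp (s * \<alpha>)"
      by (simp add: algebra_simps flip: exp_add)
    then have "exp (t * \<alpha>) * exp ((s - t) * lam j) * \<bar>W j s\<bar> \<le> exp (s * \<alpha>) * \<bar>W j s\<bar>"
      by (rule mult_right_mono) simp
    then show ?thesis by (simp add: h_def abs_mult mult.assoc)
  qed
  have hsq: "(h j s)\<^sup>2 \<le> exp (2 * s * \<alpha>) * (W j s)\<^sup>2" if "j \<in> J" "s \<in> {t..T}" for j s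
  proof -
    have "\<bar>h j s\<bar>\<^sup>2 \<le> (exp (s * \<alpha>) * \<bar>W j s\<bar>)\<^sup>2"
      using hle[OF that] by (intro power_mono) auto
    then show ?thesis
      by (simp add: power_mult_distrib mult.assoc exp_double)
  qed
  have hB: "AE s in ?M. (\<Sum>j\<in>J. (h j s)\<^sup>2) \<le> ?B s"
    using WB AE_space
  proof eventually_elim
    case (elim s)
    then have "s \<in> {t..T}" by (simp add: spM)
    then have "(\<Sum>j\<in>J. (h j s)\<^sup>2) \<le> (\<Sum>j\<in>J. exp (2 * s * \<alpha>) * (W j s)\<^sup>2)"
      by (intro sum_mono hsq)
    also have "\<dots> = exp (2 * s * \<alpha>) * (\<Sum>j\<in>J. (W j s)\<^sup>2)" by (simp add: sum_distrib_left)
    also have "\<dots> \<le> ?B s" using elim by (intro mult_left_mono) auto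
    finally show ?case .
  qed
  \<comment> \<open>The constant \<open>exp (T * \<bar>\<alpha>\<bar>)\<close> dominates the weight
    on the whole interval for either sign of \<open>\<alpha>\<close>.\<close>
  have hint: "integrable ?M (h j)" if "j \<in> J" for j
  proof (rule Bochner_Integration.integrable_bound)
    show "integrable ?M (\<lambda>s. exp (T * \<bar>\<alpha>\<bar>) * W j s)" using W[OF that] by simp
    have "\<bar>h j s\<bar> \<le> exp (T * \<bar>\<alpha>\<bar>) * \<bar>W j s\<bar>" if "s \<in> {t..T}" for s
    proof -
      have "s * \<alpha> \<le> T * \<bar>\<alpha>\<bar>"
        using that t by (intro order_trans[OF mult_left_mono[OF abs_ge_self] mult_right_mono]) auto
      then have "exp (s * \<alpha>) * \<bar>W j s\<bar> \<le> exp (T * \<bar>\<alpha>\<bar>) * \<bar>W j s\<bar>"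
        by (intro mult_right_mono) auto
      then show ?thesis using hle[OF \<open>j \<in> J\<close> that] by linarith
    qed
    then show "AE s in ?M. norm (h j s) \<le> norm (exp (T * \<bar>\<alpha>\<bar>) * W j s)"
      by (intro AE_I2) (simp add: spM abs_mult)
  qed (rule hmeas[OF that])
  \<comment> \<open>Square integrability of a single mode is inherited from \<open>B\<close>: one
    square is at most the sum of all, which lies below an integrable function.\<close>
  have hsqint: "integrable ?M (\<lambda>s. (h j s)\<^sup>2)" if "j \<in> J" for j
  proof (rule Bochner_Integration.integrable_bound[OF Bint])
    show "(\<lambda>s. (h j s)\<^sup>2) \<in> borel_measurable ?M" using hmeas[OF that] by simp
    show "AE s in ?M. norm ((h j s)\<^sup>2) \<le> norm (?B s)"
      using hB
    proof eventually_elim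
      case (elim s)
      have "(h j s)\<^sup>2 \<le> (\<Sum>j\<in>J. (h j s)\<^sup>2)"
        by (rule member_le_sum[OF that _ J(1)]) simp
      then have "(h j s)\<^sup>2 \<le> ?B s" using elim by linarith
      then show ?case by simp
    qed
  qed
  have "exp (2 * t * \<alpha>) * (\<Sum>j\<in>J. (LINT s|?M. exp ((s - t) * lam j) * W j s)\<^sup>2)
      = (\<Sum>j\<in>J. (LINT s|?M. h j s)\<^sup>2)"
    by (simp add: h_def sum_distrib_left power_mult_distrib mult.assoc exp_double)
  also have "\<dots> \<le> (\<Sum>j\<in>J. T * (LINT s|?M. (h j s)\<^sup>2))"
  proof (rule sum_mono)
    fix j assume j: "j \<in> J"
    have "(LINT s|?M. h j s)\<^sup>2 \<le> (LINT s|?M. (h j s)\<^sup>2) * (T - t)"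
      using t by (intro integral_square_le hint hsqint j) auto
    also have "\<dots> \<le> (LINT s|?M. (h j s)\<^sup>2) * T"
      using t by (intro mult_left_mono) auto
    finally show "(LINT s|?M. h j s)\<^sup>2 \<le> T * (LINT s|?M. (h j s)\<^sup>2)"
      by (simp add: mult.commute)
  qed
  \<comment> \<open>The sum goes back under the integral because \<open>B\<close> controls the modes
    only jointly.\<close>
  also have "\<dots> = T * (LINT s|?M. (\<Sum>j\<in>J. (h j s)\<^sup>2))"
    by (simp add: hsqint sum_distrib_left Bochner_Integration.integral_sum)
  also have "\<dots> \<le> T * (LINT s|?M. ?B s)"
    using t by (intro mult_left_mono integral_mono_AE Bint hB Bochner_Integration.integrable_sum hsqint) auto
  finally show ?thesis .
qed

text \<open>For a mode kept by the truncation, both solutions obey the same formula, so its error is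
  an amplified data error minus an integral of source differences. Both factors 2 come from squaring
  this difference. The full norm of the error appears under the integral because the nonlinearity
  couples all modes.\<close>

lemma low_frequency_error:
  assumes on: "L2_orthonormal \<Omega> \<phi>"
    and fin: "finite {j. 1 \<le> j \<and> lam j \<le> \<alpha>}"
    and Lip: "\<And>x t w1 w2. x \<in> \<Omega> \<Longrightarrow> t \<in> {0..T} \<Longrightarrow> \<bar>F x t w1 - F x t w2\<bar> \<le> k * \<bar>w1 - w2\<bar>"
    and u: "mild_solution \<Omega> lam \<phi> T F g u"
    and v: "regularized_mild_solution \<Omega> lam \<phi> T F \<alpha> G v"
    and t: "t \<in> {0..T}"
  shows "exp (2 * t * \<alpha>) *
      (\<Sum>j | 1 \<le> j \<and> lam j \<le> \<alpha>. (L2_inner \<Omega> (\<lambda>x. v t x - u t x) (\<phi> j))\<^sup>2)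
    \<le> 2 * exp (2 * T * \<alpha>) *
        (\<Sum>j | 1 \<le> j \<and> lam j \<le> \<alpha>. (L2_inner \<Omega> G (\<phi> j) - L2_inner \<Omega> g (\<phi> j))\<^sup>2)
      + 2 * k\<^sup>2 * T * integral {t..T}
          (\<lambda>s. exp (2 * s * \<alpha>) * L2_inner \<Omega> (\<lambda>x. v s x - u s x) (\<lambda>x. v s x - u s x))"
proof -
  let ?J = "{j. 1 \<le> j \<and> lam j \<le> \<alpha>}"
  let ?M = "lebesgue_on {t..T}"
  define N2 where "N2 = (\<lambda>s. L2_inner \<Omega> (\<lambda>x. v s x - u s x) (\<lambda>x. v s x - u s x))"
  define W where "W = (\<lambda>j s. L2_inner \<Omega> (\<lambda>x. F x s (v s x)) (\<phi> j) - L2_inner \<Omega> (\<lambda>x. F x s (u s x)) (\<phi> j))"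
  define I where "I = (\<lambda>j. LINT s|?M. exp ((s - t) * lam j) * W j s)"
  define a where "a = (\<lambda>j. L2_inner \<Omega> G (\<phi> j) - L2_inner \<Omega> g (\<phi> j))"
  have cu: "continuous_into_L2 \<Omega> T u" and cv: "continuous_into_L2 \<Omega> T v"
    and su: "admissible_source \<Omega> \<phi> T F u" and sv: "admissible_source \<Omega> \<phi> T F v"
    using u v by (auto simp: mild_solution_def regularized_mild_solution_def)
  have mem: "u s \<in> L2 \<Omega>" "v s \<in> L2 \<Omega>" if "s \<in> {0..T}" for s
    using cu cv that by (auto simp: continuous_into_L2_def)
  have N2cont: "continuous_on {t..T} N2"
    unfolding N2_def
    by (rule continuous_on_subset[OF continuous_on_L2_inner_self[OF continuous_into_L2_diff[OF cv cu]]])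
      (use t in auto)
  have sint: "integrable ?M (\<lambda>s. L2_inner \<Omega> (\<lambda>x. F x s (z s x)) (\<phi> j))"
    if "admissible_source \<Omega> \<phi> T F z" "j \<ge> 1" for z j
  proof (rule integrable_subinterval)
    show "integrable (lebesgue_on {0..T}) (\<lambda>s. L2_inner \<Omega> (\<lambda>x. F x s (z s x)) (\<phi> j))"
      using that unfolding admissible_source_def by blast
    show "{t..T} \<subseteq> {0..T}" using t by auto
  qed
  have Wint: "integrable ?M (W j)" if "j \<ge> 1" for j
    unfolding W_def by (intro Bochner_Integration.integrable_diff sint su sv that)
  \<comment> \<open>The sources are known to lie in \<open>L2 \<Omega>\<close> at almost every time
    only.\<close>
  have "AE s in lebesgue_on {0..T}. (\<Sum>j\<in>?J. (W j s)\<^sup>2) \<le> k\<^sup>2 * N2 s"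
  proof -
    have "AE s in lebesgue_on {0..T}. (\<lambda>x. F x s (u s x)) \<in> L2 \<Omega>"
      "AE s in lebesgue_on {0..T}. (\<lambda>x. F x s (v s x)) \<in> L2 \<Omega>"
      using su sv by (auto simp: admissible_source_def)
    then show ?thesis using AE_space
    proof eventually_elim
      case (elim s)
      then have s: "s \<in> {0..T}" by (simp add: space_restrict_space)
      show ?case unfolding W_def N2_def
        by (rule source_difference_Bessel[OF on fin _ elim(2,1) mem[OF s]]) (auto intro: Lip s)
    qed
  qed
  \<comment> \<open>The detour through \<open>lebesgue\<close> carries the almost-everywhere
    statement from \<open>{0..T}\<close> to the subinterval \<open>{t..T}\<close>.\<close>
  then have "AE s in lebesgue. s \<in> {0..T} \<longrightarrow> (\<Sum>j\<in>?J. (W j s)\<^sup>2) \<le> k\<^sup>2 * N2 s"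
    by (simp add: AE_restrict_space_iff)
  then have WB: "AE s in ?M. (\<Sum>j\<in>?J. (W j s)\<^sup>2) \<le> k\<^sup>2 * N2 s"
    using t by (subst AE_restrict_space_iff) (auto elim!: eventually_mono)
  \<comment> \<open>Integrability of each mild integrand is required before the difference of the
    two integrals can be written as the integral of the difference.\<close>
  have exp_int: "integrable ?M (\<lambda>s. exp ((s - t) * lam j) * L2_inner \<Omega> (\<lambda>x. F x s (z s x)) (\<phi> j))"
    if "admissible_source \<Omega> \<phi> T F z" "j \<ge> 1" for z j
  proof (rule Bochner_Integration.integrable_bound)
    show "integrable ?M (\<lambda>s. exp (T * \<bar>lam j\<bar>) * L2_inner \<Omega> (\<lambda>x. F x s (z s x)) (\<phi> j))"
      using sint[OF that] by simp
    have "(\<lambda>s. exp ((s - t) * lam j)) \<in> borel_measurable ?M"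
      by (intro continuous_imp_measurable_on_sets_lebesgue continuous_intros) auto
    then show "(\<lambda>s. exp ((s - t) * lam j) * L2_inner \<Omega> (\<lambda>x. F x s (z s x)) (\<phi> j)) \<in> borel_measurable ?M"
      using sint[OF that] by (intro borel_measurable_times) auto
    have "exp ((s - t) * lam j) \<le> exp (T * \<bar>lam j\<bar>)" if "s \<in> {t..T}" for s
    proof -
      have "(s - t) * lam j \<le> T * \<bar>lam j\<bar>"
        using that t by (intro order_trans[OF mult_left_mono[OF abs_ge_self] mult_right_mono]) auto
      then show ?thesis by simp
    qed
    then show "AE s in ?M. norm (exp ((s - t) * lam j) * L2_inner \<Omega> (\<lambda>x. F x s (z s x)) (\<phi> j))
        \<le> norm (exp (T * \<bar>lam j\<bar>) * L2_inner \<Omega> (\<lambda>x. F x s (z s x)) (\<phi> j))"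
      by (intro AE_I2) (simp add: space_restrict_space abs_mult mult_right_mono)
  qed
  have coeff: "L2_inner \<Omega> (\<lambda>x. v t x - u t x) (\<phi> j) = exp ((T - t) * lam j) * a j - I j"
    if "j \<in> ?J" for j
  proof -
    have j: "j \<ge> 1" "lam j \<le> \<alpha>" using that by auto
    have "L2_inner \<Omega> (\<lambda>x. v t x - u t x) (\<phi> j) = L2_inner \<Omega> (v t) (\<phi> j) - L2_inner \<Omega> (u t) (\<phi> j)"
      using on j by (intro L2_inner_diff_left mem[OF t]) (auto simp: L2_orthonormal_def)
    also have "\<dots> = mild_coeff \<Omega> lam \<phi> T F G v j t - mild_coeff \<Omega> lam \<phi> T F g u j t"
      using regularized_mild_solution_coeff[OF on v fin t j(1)] mild_solution_coeff[OF on u t j(1)] j(2)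
      by simp
    also have "\<dots> = exp ((T - t) * lam j) * a j - I j"
      using Bochner_Integration.integral_diff[OF exp_int[OF sv j(1)] exp_int[OF su j(1)]]
      by (simp add: mild_coeff_def a_def I_def W_def right_diff_distrib)
    finally show ?thesis .
  qed
  have "exp (2 * t * \<alpha>) * (\<Sum>j\<in>?J. (L2_inner \<Omega> (\<lambda>x. v t x - u t x) (\<phi> j))\<^sup>2)
      \<le> (\<Sum>j\<in>?J. 2 * exp (2 * T * \<alpha>) * (a j)\<^sup>2 + 2 * (exp (2 * t * \<alpha>) * (I j)\<^sup>2))"
    unfolding sum_distrib_left
  proof (rule sum_mono)
    fix j assume j: "j \<in> ?J"
    let ?e = "exp ((T - t) * lam j) * a j"
    \<comment> \<open>This square, once expanded, bounds the cross term of \<open>?e - I j\<close>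
      and yields \<open>2 * x^2 + 2 * y^2\<close>.\<close>
    have "0 \<le> (?e + I j)\<^sup>2" by simp
    then have "(?e - I j)\<^sup>2 \<le> 2 * ?e\<^sup>2 + 2 * (I j)\<^sup>2"
      unfolding power2_sum power2_diff by linarith
    then have "exp (2 * t * \<alpha>) * (?e - I j)\<^sup>2 \<le> exp (2 * t * \<alpha>) * (2 * ?e\<^sup>2 + 2 * (I j)\<^sup>2)"
      by (intro mult_left_mono) auto
    also have "\<dots> = 2 * (exp (2 * t * \<alpha>) * exp (2 * ((T - t) * lam j))) * (a j)\<^sup>2
        + 2 * (exp (2 * t * \<alpha>) * (I j)\<^sup>2)"
      unfolding exp_double[of "(T - t) * lam j"] by (simp add: power_mult_distrib algebra_simps)
    also have "exp (2 * t * \<alpha>) * exp (2 * ((T - t) * lam j)) \<le> exp (2 * T * \<alpha>)"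
    proof -
      have "(T - t) * lam j \<le> (T - t) * \<alpha>" using j t by (intro mult_left_mono) auto
      then have "2 * t * \<alpha> + 2 * ((T - t) * lam j) \<le> 2 * T * \<alpha>" by (simp add: algebra_simps)
      then show ?thesis by (simp flip: exp_add)
    qed
    finally show "exp (2 * t * \<alpha>) * (L2_inner \<Omega> (\<lambda>x. v t x - u t x) (\<phi> j))\<^sup>2
        \<le> 2 * exp (2 * T * \<alpha>) * (a j)\<^sup>2 + 2 * (exp (2 * t * \<alpha>) * (I j)\<^sup>2)"
      by (simp add: coeff[OF j] mult_left_mono mult_right_mono)
  qed
  also have "\<dots> = 2 * exp (2 * T * \<alpha>) * (\<Sum>j\<in>?J. (a j)\<^sup>2)
      + 2 * (exp (2 * t * \<alpha>) * (\<Sum>j\<in>?J. (I j)\<^sup>2))"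
    by (simp add: sum.distrib sum_distrib_left)
  also have "exp (2 * t * \<alpha>) * (\<Sum>j\<in>?J. (I j)\<^sup>2)
      \<le> T * (LINT s|?M. exp (2 * s * \<alpha>) * (k\<^sup>2 * N2 s))"
    unfolding I_def
    by (rule weighted_integral_square_le[OF t fin _ _ _ WB])
      (auto intro!: Wint continuous_intros N2cont)
  also have "(LINT s|?M. exp (2 * s * \<alpha>) * (k\<^sup>2 * N2 s)) = k\<^sup>2 * (LINT s|?M. exp (2 * s * \<alpha>) * N2 s)"
    by (subst integral_mult_right_zero[symmetric]) (simp add: mult_ac)
  \<comment> \<open>Passage to the gauge integral, in which the Gronwall inequality is stated;
    continuity of the integrand makes the two agree.\<close>
  also have "(LINT s|?M. exp (2 * s * \<alpha>) * N2 s) = integral {t..T} (\<lambda>s. exp (2 * s * \<alpha>) * N2 s)"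
    by (intro lebesgue_integral_eq_integral continuous_imp_integrable_real continuous_intros N2cont) auto
  finally show ?thesis
    by (simp add: a_def N2_def mult_ac)
qed

text \<open>A Chebyshev-type bound: when \<open>lam j \<ge> \<alpha>\<close>, inserting the factor
  \<open>exp (2 * q * (lam j - \<alpha>)) \<ge> 1\<close> only increases a term, and the weighted
  series is bounded by \<open>A\<close>.\<close>

lemma high_frequency_tail:
  assumes "finite I" "I \<subseteq> {1..}" "\<And>j. j \<in> I \<Longrightarrow> \<alpha> \<le> lam j" "0 \<le> q" "0 \<le> A"
    and "(\<Sum>j. ennreal (exp (2 * q * lam (Suc j)) * (c (Suc j))\<^sup>2)) \<le> ennreal A"
  shows "(\<Sum>j\<in>I. (c j)\<^sup>2) \<le> A * exp (- 2 * q * \<alpha>)"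
proof -
  have "(\<Sum>j\<in>I. (c j)\<^sup>2) \<le> (\<Sum>j\<in>I. exp (- 2 * q * \<alpha>) * (exp (2 * q * lam j) * (c j)\<^sup>2))"
  proof (rule sum_mono)
    fix j assume "j \<in> I"
    then have "0 \<le> q * (lam j - \<alpha>)" using assms by (intro mult_nonneg_nonneg) auto
    then have "1 \<le> exp (- 2 * q * \<alpha>) * exp (2 * q * lam j)"
      by (simp add: algebra_simps flip: exp_add)
    from mult_right_mono[OF this, of "(c j)\<^sup>2"]
    show "(c j)\<^sup>2 \<le> exp (- 2 * q * \<alpha>) * (exp (2 * q * lam j) * (c j)\<^sup>2)"
      by (simp add: mult.assoc del: mult_minus_left)
  qed
  also have "\<dots> = exp (- 2 * q * \<alpha>) * (\<Sum>j\<in>I. exp (2 * q * lam j) * (c j)\<^sup>2)"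
    by (simp add: sum_distrib_left)
  also have "\<dots> \<le> exp (- 2 * q * \<alpha>) * A"
    using assms by (intro mult_left_mono sum_le_of_ennreal_suminf[where a = "\<lambda>j. exp (2 * q * lam j) * (c j)\<^sup>2"]) auto
  finally show ?thesis by (simp add: mult.commute)
qed

text \<open>The weight \<open>exp (2 * s * \<alpha>)\<close> cancels the dependence on
  \<open>s\<close> of the tail bound \<open>A * exp (- 2 * (s + r) * \<alpha>)\<close>. What remains
  is a constant plus \<open>2 * k^2 * T\<close> times the integral of the weighted squared norm
  \<open>Y\<close>, the form that Gronwall accepts.\<close>

lemma regularized_error_L2:
  assumes on: "L2_orthonormal \<Omega> \<phi>"
    and fin: "finite {j. 1 \<le> j \<and> lam j \<le> \<alpha>}"
    and Lip: "\<And>x t w1 w2. x \<in> \<Omega> \<Longrightarrow> t \<in> {0..T} \<Longrightarrow> \<bar>F x t w1 - F x t w2\<bar> \<le> k * \<bar>w1 - w2\<bar>"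
    and u: "mild_solution \<Omega> lam \<phi> T F g u"
    and v: "regularized_mild_solution \<Omega> lam \<phi> T F \<alpha> G v"
    and "0 \<le> r" "0 \<le> A"
    and tail: "\<And>s. s \<in> {0..T} \<Longrightarrow>
      (\<Sum>j. ennreal (exp (2 * (s + r) * lam (Suc j)) * (L2_inner \<Omega> (u s) (\<phi> (Suc j)))\<^sup>2)) \<le> ennreal A"
    and t: "t \<in> {0..T}"
  shows "L2_inner \<Omega> (\<lambda>x. v t x - u t x) (\<lambda>x. v t x - u t x)
    \<le> exp (2 * k\<^sup>2 * T * (T - t)) * exp (- 2 * t * \<alpha>) *
      (2 * exp (2 * T * \<alpha>) *
        (\<Sum>j | 1 \<le> j \<and> lam j \<le> \<alpha>. (L2_inner \<Omega> G (\<phi> j) - L2_inner \<Omega> g (\<phi> j))\<^sup>2)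
       + A * exp (- 2 * r * \<alpha>))"
proof -
  let ?J = "{j. 1 \<le> j \<and> lam j \<le> \<alpha>}"
  define w where "w = (\<lambda>s x. v s x - u s x)"
  define E where "E = (\<Sum>j\<in>?J. (L2_inner \<Omega> G (\<phi> j) - L2_inner \<Omega> g (\<phi> j))\<^sup>2)"
  define Y where "Y = (\<lambda>s. exp (2 * s * \<alpha>) * L2_inner \<Omega> (w s) (w s))"
  have cu: "continuous_into_L2 \<Omega> T u" and cv: "continuous_into_L2 \<Omega> T v"
    using u v by (auto simp: mild_solution_def regularized_mild_solution_def)
  have mem: "u s \<in> L2 \<Omega>" "v s \<in> L2 \<Omega>" if "s \<in> {0..T}" for s
    using cu cv that by (auto simp: continuous_into_L2_def)
  have Ycont: "continuous_on {0..T} Y"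
    unfolding Y_def w_def
    by (intro continuous_intros continuous_on_L2_inner_self continuous_into_L2_diff cu cv)
  have split: "L2_inner \<Omega> (w s) (w s) \<le> (\<Sum>j\<in>?J. (L2_inner \<Omega> (w s) (\<phi> j))\<^sup>2) + A * exp (- 2 * (s + r) * \<alpha>)"
    if s: "s \<in> {0..T}" for s
  \<comment> \<open>By Parseval the squared norm is a limit of finite coefficient sums, so a bound
    uniform in \<open>n\<close> for these suffices.\<close>
  proof (rule LIMSEQ_le_const2)
    show "(\<lambda>n. \<Sum>j=1..n. (L2_inner \<Omega> (w s) (\<phi> j))\<^sup>2) \<longlonglongrightarrow> L2_inner \<Omega> (w s) (w s)"
      unfolding w_def
      by (rule L2_Parseval_diff[OF on fin _ mem[OF s],
            where c = "\<lambda>j. mild_coeff \<Omega> lam \<phi> T F G v j s" and d = "\<lambda>j. mild_coeff \<Omega> lam \<phi> T F g u j s"])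
        (use u v s in \<open>auto simp: mild_solution_def regularized_mild_solution_def\<close>)
    have "(\<Sum>j=1..n. (L2_inner \<Omega> (w s) (\<phi> j))\<^sup>2)
        \<le> (\<Sum>j\<in>?J. (L2_inner \<Omega> (w s) (\<phi> j))\<^sup>2) + A * exp (- 2 * (s + r) * \<alpha>)" for n
    proof -
      have "(\<Sum>j=1..n. (L2_inner \<Omega> (w s) (\<phi> j))\<^sup>2)
          \<le> (\<Sum>j\<in>?J \<union> ({1..n} - ?J). (L2_inner \<Omega> (w s) (\<phi> j))\<^sup>2)"
        using fin by (intro sum_mono2) auto
      also have "\<dots> = (\<Sum>j\<in>?J. (L2_inner \<Omega> (w s) (\<phi> j))\<^sup>2)
          + (\<Sum>j\<in>{1..n} - ?J. (L2_inner \<Omega> (w s) (\<phi> j))\<^sup>2)"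
        using fin by (intro sum.union_disjoint) auto
      also have "(\<Sum>j\<in>{1..n} - ?J. (L2_inner \<Omega> (w s) (\<phi> j))\<^sup>2)
          = (\<Sum>j\<in>{1..n} - ?J. (L2_inner \<Omega> (u s) (\<phi> j))\<^sup>2)"
      proof (intro sum.cong refl)
        fix j assume j: "j \<in> {1..n} - ?J"
        then have "\<phi> j \<in> L2 \<Omega>" using on by (simp add: L2_orthonormal_def)
        then show "(L2_inner \<Omega> (w s) (\<phi> j))\<^sup>2 = (L2_inner \<Omega> (u s) (\<phi> j))\<^sup>2"
          using j regularized_mild_solution_coeff[OF on v fin s, of j]
          by (auto simp: w_def L2_inner_diff_left mem[OF s])
      qed
      also have "\<dots> \<le> A * exp (- 2 * (s + r) * \<alpha>)"
        using s \<open>0 \<le> r\<close> \<open>0 \<le> A\<close> tail[OF s]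
        by (intro high_frequency_tail[where lam = lam]) auto
      finally show ?thesis by simp
    qed
    then show "\<exists>N. \<forall>n\<ge>N. (\<Sum>j=1..n. (L2_inner \<Omega> (w s) (\<phi> j))\<^sup>2)
        \<le> (\<Sum>j\<in>?J. (L2_inner \<Omega> (w s) (\<phi> j))\<^sup>2) + A * exp (- 2 * (s + r) * \<alpha>)" by blast
  qed
  have "Y s \<le> (2 * exp (2 * T * \<alpha>) * E + A * exp (- 2 * r * \<alpha>)) + 2 * k\<^sup>2 * T * integral {s..T} Y"
    if s: "s \<in> {0..T}" for s
  proof -
    have "Y s \<le> exp (2 * s * \<alpha>) * ((\<Sum>j\<in>?J. (L2_inner \<Omega> (w s) (\<phi> j))\<^sup>2) + A * exp (- 2 * (s + r) * \<alpha>))"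
      unfolding Y_def using split[OF s] by (intro mult_left_mono) auto
    also have "\<dots> = exp (2 * s * \<alpha>) * (\<Sum>j\<in>?J. (L2_inner \<Omega> (w s) (\<phi> j))\<^sup>2) + A * exp (- 2 * r * \<alpha>)"
      by (simp add: algebra_simps flip: exp_add)
    also have "exp (2 * s * \<alpha>) * (\<Sum>j\<in>?J. (L2_inner \<Omega> (w s) (\<phi> j))\<^sup>2)
        \<le> 2 * exp (2 * T * \<alpha>) * E + 2 * k\<^sup>2 * T * integral {s..T} Y"
      unfolding E_def Y_def w_def by (rule low_frequency_error[OF on fin Lip u v s])
    finally show ?thesis by simp
  qed
  then have Yt: "Y t \<le> (2 * exp (2 * T * \<alpha>) * E + A * exp (- 2 * r * \<alpha>)) * exp (2 * k\<^sup>2 * T * (T - t))"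
    using t by (intro gronwall_backward[OF Ycont _ t]) auto
  have "L2_inner \<Omega> (w t) (w t) = exp (- 2 * t * \<alpha>) * Y t"
    unfolding Y_def mult.assoc[symmetric] exp_add[symmetric] by simp
  also have "\<dots> \<le> exp (- 2 * t * \<alpha>) * ((2 * exp (2 * T * \<alpha>) * E + A * exp (- 2 * r * \<alpha>)) * exp (2 * k\<^sup>2 * T * (T - t)))"
    by (intro mult_left_mono Yt) auto
  finally show ?thesis by (simp only: w_def E_def mult_ac)
qed

section \<open>From the error in \<open>L2 \<Omega>\<close> to the \<open>H^p\<close> norm\<close>

text \<open>The logarithmic derivative \<open>p / x - 2 * q\<close> is nonpositive from
  \<open>x = p / (2 * q)\<close> on when \<open>q > 0\<close>, and
  \<open>p \<le> 2 * q * \<alpha>\<close> places \<open>\<alpha>\<close> beyond that point. Instead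
  of differentiating, the proof applies \<open>ln y \<le> y - 1\<close> to
  \<open>y = x / \<alpha>\<close>.\<close>

lemma powr_exp_antimono:
  fixes \<alpha> p q x :: real
  assumes "0 < \<alpha>" "\<alpha> \<le> x" "0 \<le> p" "p \<le> 2 * q * \<alpha>"
  shows "x powr p * exp (- 2 * q * x) \<le> \<alpha> powr p * exp (- 2 * q * \<alpha>)"
proof -
  have "ln x - ln \<alpha> = ln (x / \<alpha>)" using assms by (simp add: ln_div)
  also have "\<dots> \<le> x / \<alpha> - 1" using assms by (intro ln_le_minus_one) auto
  finally have "p * (ln x - ln \<alpha>) \<le> p * (x / \<alpha> - 1)" using assms by (intro mult_left_mono)
  also have "\<dots> \<le> 2 * q * \<alpha> * (x / \<alpha> - 1)" using assms by (intro mult_right_mono) auto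
  also have "\<dots> = 2 * q * (x - \<alpha>)" using assms by (simp add: field_simps)
  finally have "p * ln x + - 2 * q * x \<le> p * ln \<alpha> + - 2 * q * \<alpha>" by (simp add: algebra_simps)
  then have "exp (p * ln x) * exp (- 2 * q * x) \<le> exp (p * ln \<alpha>) * exp (- 2 * q * \<alpha>)"
    unfolding exp_add[symmetric] by simp
  then show ?thesis using assms by (simp add: powr_def)
qed

text \<open>Low modes lose at most \<open>\<alpha> powr p\<close> and Bessel sums them. On high
  modes \<open>lam j powr p\<close> is split as a decreasing factor times
  \<open>exp (2 * q * lam j)\<close>, and the latter is absorbed by the weighted series. The
  sequence \<open>c\<close> stands for the coefficients of \<open>u\<close>, which give the error
  there.\<close>

lemma Hp_norm_sq_split_le:
  assumes on: "L2_orthonormal \<Omega> \<phi>" and w: "w \<in> L2 \<Omega>" and pos: "\<And>j. j \<ge> 1 \<Longrightarrow> 0 < lam j"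
    and high: "\<And>j. j \<ge> 1 \<Longrightarrow> \<alpha> < lam j \<Longrightarrow> (L2_inner \<Omega> w (\<phi> j))\<^sup>2 = (c j)\<^sup>2"
    and tail: "(\<Sum>j. ennreal (exp (2 * q * lam (Suc j)) * (c (Suc j))\<^sup>2)) \<le> ennreal A"
    and "0 \<le> A" and "0 < \<alpha>" "0 \<le> p" "p \<le> 2 * q * \<alpha>"
  shows "Hp_norm_sq \<Omega> lam \<phi> p w
    \<le> ennreal (\<alpha> powr p * L2_inner \<Omega> w w + A * \<alpha> powr p * exp (- 2 * q * \<alpha>))"
proof -
  define a where "a = (\<lambda>j. \<alpha> powr p * (L2_inner \<Omega> w (\<phi> (Suc j)))\<^sup>2)"
  define b where "b = (\<lambda>j. exp (2 * q * lam (Suc j)) * (c (Suc j))\<^sup>2)"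
  let ?D = "\<alpha> powr p * exp (- 2 * q * \<alpha>)"
  \<comment> \<open>Each term is bounded by the sum of both bounds, which avoids cutting the
    infinite series into two.\<close>
  have "lam (Suc j) powr p * (L2_inner \<Omega> w (\<phi> (Suc j)))\<^sup>2 \<le> a j + ?D * b j" for j
  proof (cases "lam (Suc j) \<le> \<alpha>")
    case True
    then have "lam (Suc j) powr p \<le> \<alpha> powr p"
      using pos[of "Suc j"] \<open>0 \<le> p\<close> by (intro powr_mono2) auto
    then have "lam (Suc j) powr p * (L2_inner \<Omega> w (\<phi> (Suc j)))\<^sup>2 \<le> a j"
      unfolding a_def by (rule mult_right_mono) simp
    moreover have "0 \<le> ?D * b j" by (simp add: b_def)
    ultimately show ?thesis by linarith
  next
    case False
    let ?l = "lam (Suc j)"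
    have "?l powr p = ?l powr p * exp (- 2 * q * ?l) * exp (2 * q * ?l)"
      by (simp add: mult.assoc flip: exp_add)
    also have "\<dots> \<le> ?D * exp (2 * q * ?l)"
      using False assms by (intro mult_right_mono powr_exp_antimono) auto
    finally have "?l powr p * (c (Suc j))\<^sup>2 \<le> ?D * exp (2 * q * ?l) * (c (Suc j))\<^sup>2"
      by (rule mult_right_mono) simp
    then have "?l powr p * (L2_inner \<Omega> w (\<phi> (Suc j)))\<^sup>2 \<le> ?D * b j"
      using high[of "Suc j"] False by (simp add: b_def mult.assoc)
    moreover have "0 \<le> a j" by (simp add: a_def)
    ultimately show ?thesis by linarith
  qed
  then have "Hp_norm_sq \<Omega> lam \<phi> p w \<le> (\<Sum>j. ennreal (a j) + ennreal ?D * ennreal (b j))"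
    unfolding Hp_norm_sq_def
    by (intro suminf_le summableI) (simp add: a_def b_def flip: ennreal_plus ennreal_mult)
  also have "\<dots> = (\<Sum>j. ennreal (a j)) + ennreal ?D * (\<Sum>j. ennreal (b j))"
    by (subst suminf_add[symmetric]) (auto intro!: summableI)
  also have "\<dots> \<le> ennreal (\<alpha> powr p * L2_inner \<Omega> w w) + ennreal ?D * ennreal A"
  proof (intro add_mono mult_left_mono)
    show "(\<Sum>j. ennreal (a j)) \<le> ennreal (\<alpha> powr p * L2_inner \<Omega> w w)"
    proof (rule suminf_le_const[OF summableI])
      fix n
      have "(\<Sum>j<n. (L2_inner \<Omega> w (\<phi> (Suc j)))\<^sup>2) = (\<Sum>j\<in>Suc ` {..<n}. (L2_inner \<Omega> w (\<phi> j))\<^sup>2)"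
        by (simp add: sum.reindex)
      also have "\<dots> \<le> L2_inner \<Omega> w w"
        by (rule L2_Bessel[OF on _ _ w]) auto
      finally have "(\<Sum>j<n. a j) \<le> \<alpha> powr p * L2_inner \<Omega> w w"
        unfolding a_def sum_distrib_left[symmetric] by (rule mult_left_mono) simp
      then show "(\<Sum>j<n. ennreal (a j)) \<le> ennreal (\<alpha> powr p * L2_inner \<Omega> w w)"
        by (simp add: a_def sum_ennreal ennreal_leI)
    qed
  qed (use tail in \<open>auto simp: b_def\<close>)
  also have "\<dots> = ennreal (\<alpha> powr p * L2_inner \<Omega> w w + ?D * A)"
    using \<open>0 \<le> A\<close> by (simp add: L2_inner_self_nonneg flip: ennreal_plus ennreal_mult)
  finally show ?thesis by (simp only: mult_ac)
qed

section \<open>Expectation over the noise\<close>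

text \<open>Up to \<open>N\<close> the coefficient error is pure noise
  \<open>\<delta> * \<xi> j \<omega>\<close>. Beyond \<open>N\<close> nothing is observed and the
  error is minus the coefficient of \<open>g\<close>, whose smoothness gains
  \<open>lam N powr (2 * \<gamma>)\<close> because the eigenvalues increase.\<close>

lemma data_error_le:
  assumes es: "dirichlet_eigensystem \<Omega> lam \<phi>" and g: "g \<in> Hp_space \<Omega> lam \<phi> (2 * \<gamma>)"
    and J: "finite J" "J \<subseteq> {1..}" and "1 \<le> N" "0 \<le> \<gamma>"
  shows "(\<Sum>j\<in>J. (L2_inner \<Omega> (observed_data \<Omega> \<phi> \<xi> g \<delta> N \<omega>) (\<phi> j) - L2_inner \<Omega> g (\<phi> j))\<^sup>2)
    \<le> \<delta>\<^sup>2 * (\<Sum>j=1..N. (\<xi> j \<omega>)\<^sup>2)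
      + enn2real (Hp_norm_sq \<Omega> lam \<phi> (2 * \<gamma>) g) / lam N powr (2 * \<gamma>)"
proof -
  note on = dirichlet_eigensystem_orthonormal[OF es]
  let ?e = "\<lambda>j. (L2_inner \<Omega> (observed_data \<Omega> \<phi> \<xi> g \<delta> N \<omega>) (\<phi> j) - L2_inner \<Omega> g (\<phi> j))\<^sup>2"
  let ?G = "enn2real (Hp_norm_sq \<Omega> lam \<phi> (2 * \<gamma>) g)"
  have "(\<Sum>j\<in>J. ?e j) = (\<Sum>j\<in>J \<inter> {..N}. ?e j) + (\<Sum>j\<in>J - {..N}. ?e j)"
    using J(1) by (rule sum.Int_Diff)
  also have "(\<Sum>j\<in>J \<inter> {..N}. ?e j) = (\<Sum>j\<in>J \<inter> {..N}. \<delta>\<^sup>2 * (\<xi> j \<omega>)\<^sup>2)"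
  proof (intro sum.cong refl)
    fix j assume "j \<in> J \<inter> {..N}"
    then have "j \<ge> 1" "j \<le> N" using J by auto
    then show "?e j = \<delta>\<^sup>2 * (\<xi> j \<omega>)\<^sup>2"
      using observed_data_coeff[OF on, of j \<xi> g \<delta> N \<omega>] by (simp add: power_mult_distrib)
  qed
  also have "\<dots> \<le> (\<Sum>j=1..N. \<delta>\<^sup>2 * (\<xi> j \<omega>)\<^sup>2)"
    using J by (intro sum_mono2) auto
  also have "\<dots> = \<delta>\<^sup>2 * (\<Sum>j=1..N. (\<xi> j \<omega>)\<^sup>2)"
    by (simp add: sum_distrib_left)
  also have "(\<Sum>j\<in>J - {..N}. ?e j) \<le> ?G / lam N powr (2 * \<gamma>)"
  proof -
    have lN: "0 < lam N powr (2 * \<gamma>)"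
      using dirichlet_eigensystem_pos[OF es \<open>1 \<le> N\<close>] by simp
    have "(\<Sum>j\<in>J - {..N}. ?e j) * lam N powr (2 * \<gamma>)
        \<le> (\<Sum>j\<in>J - {..N}. lam j powr (2 * \<gamma>) * (L2_inner \<Omega> g (\<phi> j))\<^sup>2)"
      unfolding sum_distrib_right
    proof (rule sum_mono)
      fix j assume "j \<in> J - {..N}"
      then have j: "j \<ge> 1" "N < j" using J by auto
      have "lam N \<le> lam j" using es j \<open>1 \<le> N\<close> by (simp add: dirichlet_eigensystem_def)
      then have "lam N powr (2 * \<gamma>) \<le> lam j powr (2 * \<gamma>)"
        using dirichlet_eigensystem_pos[OF es \<open>1 \<le> N\<close>] \<open>0 \<le> \<gamma>\<close> by (intro powr_mono2) auto
      then have "lam N powr (2 * \<gamma>) * (L2_inner \<Omega> g (\<phi> j))\<^sup>2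
          \<le> lam j powr (2 * \<gamma>) * (L2_inner \<Omega> g (\<phi> j))\<^sup>2"
        by (rule mult_right_mono) simp
      then show "?e j * lam N powr (2 * \<gamma>) \<le> lam j powr (2 * \<gamma>) * (L2_inner \<Omega> g (\<phi> j))\<^sup>2"
        using observed_data_coeff[OF on j(1), of \<xi> g \<delta> N \<omega>] j by (simp add: mult.commute)
    qed
    also have "\<dots> \<le> ?G"
    proof (rule sum_le_of_ennreal_suminf)
      \<comment> \<open>Finiteness is essential here, since \<open>enn2real\<close> sends infinity
        to 0.\<close>
      have "Hp_norm_sq \<Omega> lam \<phi> (2 * \<gamma>) g < \<infinity>" using g by (simp add: Hp_space_def)
      then show "(\<Sum>j. ennreal (lam (Suc j) powr (2 * \<gamma>) * (L2_inner \<Omega> g (\<phi> (Suc j)))\<^sup>2)) \<le> ennreal ?G"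
        unfolding Hp_norm_sq_def[symmetric] by simp
    qed (use J in auto)
    finally show ?thesis using lN by (simp add: pos_le_divide_eq)
  qed
  finally show ?thesis by simp
qed

text \<open>Linearity of the integral, with unit second moments and total mass 1. Nonnegative
  \<open>c\<close> and \<open>d\<close> allow \<open>ennreal\<close> to be distributed over the
  expression.\<close>

lemma white_noise_affine_expectation:
  assumes wn: "white_noise_coeffs M \<xi>" and "0 \<le> c" "0 \<le> d"
  shows "(\<integral>\<^sup>+\<omega>. ennreal (c * (\<Sum>j=1..N. (\<xi> j \<omega>)\<^sup>2) + d) \<partial>M) = ennreal (c * real N + d)"
proof -
  interpret prob_space M using wn by (simp add: white_noise_coeffs_def)
  have meas: "(\<lambda>\<omega>. ennreal ((\<xi> j \<omega>)\<^sup>2)) \<in> borel_measurable M" if "j \<in> {1..N}" for j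
    using white_noise_measurable[OF wn, of j] that by simp
  have "ennreal (c * (\<Sum>j=1..N. (\<xi> j \<omega>)\<^sup>2) + d)
      = ennreal c * (\<Sum>j=1..N. ennreal ((\<xi> j \<omega>)\<^sup>2)) + ennreal d" for \<omega>
    using assms(2,3) by (simp add: sum_ennreal sum_nonneg ennreal_mult ennreal_plus)
  then have "(\<integral>\<^sup>+\<omega>. ennreal (c * (\<Sum>j=1..N. (\<xi> j \<omega>)\<^sup>2) + d) \<partial>M)
      = (\<integral>\<^sup>+\<omega>. ennreal c * (\<Sum>j=1..N. ennreal ((\<xi> j \<omega>)\<^sup>2)) + ennreal d \<partial>M)"
    by simp
  also have "\<dots> = ennreal c * (\<integral>\<^sup>+\<omega>. (\<Sum>j=1..N. ennreal ((\<xi> j \<omega>)\<^sup>2)) \<partial>M) + ennreal d"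
    using borel_measurable_sum[OF meas, of "{1..N}" "\<lambda>j. j"]
    by (simp add: nn_integral_add nn_integral_cmult emeasure_space_1 del: sum_ennreal)
  also have "(\<integral>\<^sup>+\<omega>. (\<Sum>j=1..N. ennreal ((\<xi> j \<omega>)\<^sup>2)) \<partial>M)
      = (\<Sum>j=1..N. (\<integral>\<^sup>+\<omega>. ennreal ((\<xi> j \<omega>)\<^sup>2) \<partial>M))"
    by (rule nn_integral_sum[OF meas])
  also have "ennreal c * \<dots> + ennreal d = ennreal c * of_nat N + ennreal d"
    using white_noise_second_moment[OF wn] by simp
  also have "\<dots> = ennreal (c * real N + d)"
    using assms(2,3) by (simp add: ennreal_mult ennreal_plus ennreal_of_nat_eq_real_of_nat)
  finally show ?thesis .
qed

text \<open>Integrates the pathwise estimate. The main term comes out with leading factor 1, half of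
  that in the final theorem.\<close>

lemma regularized_error_expectation:
  assumes es: "dirichlet_eigensystem \<Omega> lam \<phi>" and wn: "white_noise_coeffs M \<xi>"
    and Lip: "\<And>x t w1 w2. x \<in> \<Omega> \<Longrightarrow> t \<in> {0..T} \<Longrightarrow> \<bar>F x t w1 - F x t w2\<bar> \<le> k * \<bar>w1 - w2\<bar>"
    and "0 \<le> \<gamma>" and g: "g \<in> Hp_space \<Omega> lam \<phi> (2 * \<gamma>)"
    and u: "mild_solution \<Omega> lam \<phi> T F g u"
    and "0 \<le> r" "0 \<le> A"
    and tail: "\<And>s. s \<in> {0..T} \<Longrightarrow>
      (\<Sum>j. ennreal (exp (2 * (s + r) * lam (Suc j)) * (L2_inner \<Omega> (u s) (\<phi> (Suc j)))\<^sup>2)) \<le> ennreal A"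
    and "1 \<le> N" "0 < \<alpha>" "0 \<le> p" and t: "t \<in> {0..T}" and "p \<le> 2 * (t + r) * \<alpha>"
    and v: "AE \<omega> in M. regularized_mild_solution \<Omega> lam \<phi> T F \<alpha> (observed_data \<Omega> \<phi> \<xi> g \<delta> N \<omega>) (v \<omega>)"
  shows "(\<integral>\<^sup>+\<omega>. Hp_norm_sq \<Omega> lam \<phi> p (\<lambda>x. v \<omega> t x - u t x) \<partial>M)
    \<le> ennreal (exp (2 * k\<^sup>2 * T * (T - t)) * exp (- 2 * t * \<alpha>) * \<alpha> powr p *
        (2 * \<delta>\<^sup>2 * real N * exp (2 * T * \<alpha>)
         + 2 * (exp (2 * T * \<alpha>) / lam N powr (2 * \<gamma>)) * enn2real (Hp_norm_sq \<Omega> lam \<phi> (2 * \<gamma>) g)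
         + A * exp (- 2 * r * \<alpha>))
      + A * \<alpha> powr p * exp (- 2 * (t + r) * \<alpha>))"
proof -
  note on = dirichlet_eigensystem_orthonormal[OF es]
  note fin = dirichlet_eigensystem_finite_le[OF es, of \<alpha>]
  define C where "C = exp (2 * k\<^sup>2 * T * (T - t)) * exp (- 2 * t * \<alpha>) * \<alpha> powr p"
  define B where "B = enn2real (Hp_norm_sq \<Omega> lam \<phi> (2 * \<gamma>) g) / lam N powr (2 * \<gamma>)"
  define D where "D = A * \<alpha> powr p * exp (- 2 * (t + r) * \<alpha>)"
  \<comment> \<open>\<open>c\<close> collects what multiplies the squared noise; \<open>d\<close>
    collects the deterministic contributions of the unobserved part of \<open>g\<close> and of the
    tail of \<open>u\<close>.\<close>
  define c where "c = C * (2 * exp (2 * T * \<alpha>) * \<delta>\<^sup>2)"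
  define d where "d = C * (2 * exp (2 * T * \<alpha>) * B + A * exp (- 2 * r * \<alpha>)) + D"
  have nonneg: "0 \<le> C" "0 \<le> B" "0 \<le> D" using \<open>0 \<le> A\<close> by (simp_all add: C_def B_def D_def)
  have cd: "0 \<le> c" "0 \<le> d" using nonneg \<open>0 \<le> A\<close> by (simp_all add: c_def d_def)
  have "(\<integral>\<^sup>+\<omega>. Hp_norm_sq \<Omega> lam \<phi> p (\<lambda>x. v \<omega> t x - u t x) \<partial>M)
      \<le> (\<integral>\<^sup>+\<omega>. ennreal (c * (\<Sum>j=1..N. (\<xi> j \<omega>)\<^sup>2) + d) \<partial>M)"
  proof (rule nn_integral_mono_AE)
    show "AE \<omega> in M. Hp_norm_sq \<Omega> lam \<phi> p (\<lambda>x. v \<omega> t x - u t x)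
        \<le> ennreal (c * (\<Sum>j=1..N. (\<xi> j \<omega>)\<^sup>2) + d)"
      using v
    proof eventually_elim
      case (elim \<omega>)
      let ?w = "\<lambda>x. v \<omega> t x - u t x"
      let ?E = "\<Sum>j | 1 \<le> j \<and> lam j \<le> \<alpha>.
        (L2_inner \<Omega> (observed_data \<Omega> \<phi> \<xi> g \<delta> N \<omega>) (\<phi> j) - L2_inner \<Omega> g (\<phi> j))\<^sup>2"
      let ?S = "\<Sum>j=1..N. (\<xi> j \<omega>)\<^sup>2"
      have mem: "u t \<in> L2 \<Omega>" "v \<omega> t \<in> L2 \<Omega>"
        using u elim t by (auto simp: mild_solution_def regularized_mild_solution_def continuous_into_L2_def)
      have "Hp_norm_sq \<Omega> lam \<phi> p ?w \<le> ennreal (\<alpha> powr p * L2_inner \<Omega> ?w ?w + D)"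
        unfolding D_def
      proof (rule Hp_norm_sq_split_le[OF on _ _ _ tail[OF t]])
        fix j :: nat assume j: "1 \<le> j" "\<alpha> < lam j"
        then have "\<phi> j \<in> L2 \<Omega>" using on by (simp add: L2_orthonormal_def)
        then show "(L2_inner \<Omega> ?w (\<phi> j))\<^sup>2 = (L2_inner \<Omega> (u t) (\<phi> j))\<^sup>2"
          using j regularized_mild_solution_coeff[OF on elim fin t j(1)]
          by (simp add: L2_inner_diff_left mem)
      qed (use assms mem dirichlet_eigensystem_pos[OF es] in \<open>auto intro: L2_diff\<close>)
      also have "\<alpha> powr p * L2_inner \<Omega> ?w ?w + D \<le> c * ?S + d"
      proof -
        have E: "?E \<le> \<delta>\<^sup>2 * ?S + B"
          unfolding B_def using assms by (intro data_error_le es g fin) auto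
        have "\<alpha> powr p * L2_inner \<Omega> ?w ?w
            \<le> \<alpha> powr p * (exp (2 * k\<^sup>2 * T * (T - t)) * exp (- 2 * t * \<alpha>) *
                (2 * exp (2 * T * \<alpha>) * ?E + A * exp (- 2 * r * \<alpha>)))"
          by (intro mult_left_mono regularized_error_L2[OF on fin Lip u elim \<open>0 \<le> r\<close> \<open>0 \<le> A\<close> tail t]) auto
        also have "\<dots> = C * (2 * exp (2 * T * \<alpha>) * ?E + A * exp (- 2 * r * \<alpha>))"
          by (simp only: C_def mult_ac)
        also have "\<dots> \<le> C * (2 * exp (2 * T * \<alpha>) * (\<delta>\<^sup>2 * ?S + B) + A * exp (- 2 * r * \<alpha>))"
          by (intro mult_left_mono add_right_mono E nonneg) auto
        also have "\<dots> + D = c * ?S + d"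
          by (simp add: c_def d_def algebra_simps)
        finally show ?thesis by simp
      qed
      finally show ?case by (simp add: ennreal_leI)
    qed
  qed
  also have "\<dots> = ennreal (c * real N + d)"
    by (rule white_noise_affine_expectation[OF wn cd])
  also have "c * real N + d = C * (2 * \<delta>\<^sup>2 * real N * exp (2 * T * \<alpha>)
      + 2 * (exp (2 * T * \<alpha>) / lam N powr (2 * \<gamma>)) * enn2real (Hp_norm_sq \<Omega> lam \<phi> (2 * \<gamma>) g)
      + A * exp (- 2 * r * \<alpha>)) + D"
    by (simp add: c_def d_def B_def algebra_simps)
  finally show ?thesis by (simp only: C_def D_def)
qed

text \<open>The condition \<open>p \<le> 2 * (t + r) * \<alpha> \<delta>\<close> puts the cutoff
  beyond the maximum of \<open>x powr p * exp (- 2 * (t + r) * x)\<close>, as the tail bound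
  requires. It holds for all small \<open>\<delta>\<close>, uniformly in \<open>t\<close>, because
  the cutoff tends to infinity and \<open>t + r \<ge> r > 0\<close>.\<close>

theorem theorem4p2:
  fixes \<Omega> :: "'a::euclidean_space set"
    and lam :: "nat \<Rightarrow> real" and \<phi> :: "nat \<Rightarrow> 'a \<Rightarrow> real"
    and F :: "'a \<Rightarrow> real \<Rightarrow> real \<Rightarrow> real" and g :: "'a \<Rightarrow> real"
    and T k p \<gamma> r A :: real
    and u :: "real \<Rightarrow> 'a \<Rightarrow> real"
    and M :: "'w measure" and \<xi> :: "nat \<Rightarrow> 'w \<Rightarrow> real"
    and N :: "real \<Rightarrow> nat" and \<alpha> :: "real \<Rightarrow> real"
    and u\<delta> :: "real \<Rightarrow> 'w \<Rightarrow> real \<Rightarrow> 'a \<Rightarrow> real"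
  assumes "bounded \<Omega>" and "connected \<Omega>" and "open \<Omega>" and "smooth_boundary \<Omega>"
    and "dirichlet_eigensystem \<Omega> lam \<phi>"
    and "white_noise_coeffs M \<xi>"
    and "T > 0" and "p > 0" and "\<gamma> \<ge> 0" and "r > 0"
    and "\<And>x t w1 w2. x \<in> \<Omega> \<Longrightarrow> t \<in> {0..T} \<Longrightarrow> \<bar>F x t w1 - F x t w2\<bar> \<le> k * \<bar>w1 - w2\<bar>"
    and "g \<in> Hp_space \<Omega> lam \<phi> (2 * \<gamma>)"
    and "unique_solution \<Omega> T (mild_solution \<Omega> lam \<phi> T F g) u"
    and "\<And>t. t \<in> {0..T} \<Longrightarrow>
           (\<Sum>j. ennreal (exp (2 * (t + r) * lam (Suc j)) * (L2_inner \<Omega> (u t) (\<phi> (Suc j)))\<^sup>2))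
             < ennreal A"
    and "\<And>\<delta>. \<delta> > 0 \<Longrightarrow> N \<delta> \<ge> 1" and "\<And>\<delta>. \<delta> > 0 \<Longrightarrow> \<alpha> \<delta> > 0"
    and "filterlim N at_top (at_right 0)"
    and "filterlim \<alpha> at_top (at_right 0)"
    and "((\<lambda>\<delta>. exp (k * T * \<alpha> \<delta>) / lam (N \<delta>) powr \<gamma>) \<longlongrightarrow> 0) (at_right 0)"
    and "((\<lambda>\<delta>. exp (k * T * \<alpha> \<delta>) * sqrt (real (N \<delta>)) * \<delta>) \<longlongrightarrow> 0) (at_right 0)"
    and "\<And>\<delta>. \<delta> > 0 \<Longrightarrow> AE \<omega> in M. unique_solution \<Omega> T
           (regularized_mild_solution \<Omega> lam \<phi> T F (\<alpha> \<delta>) (observed_data \<Omega> \<phi> \<xi> g \<delta> (N \<delta>) \<omega>))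
           (u\<delta> \<delta> \<omega>)"
  shows "let estimate = (\<lambda>\<delta> t.
            (\<integral>\<^sup>+\<omega>. Hp_norm_sq \<Omega> lam \<phi> p (\<lambda>x. u\<delta> \<delta> \<omega> t x - u t x) \<partial>M)
            \<le> ennreal (
                2 * exp (2 * k\<^sup>2 * T * (T - t)) * exp (- 2 * t * \<alpha> \<delta>) * \<bar>\<alpha> \<delta>\<bar> powr p *
                  (2 * \<delta>\<^sup>2 * real (N \<delta>) * exp (2 * T * \<alpha> \<delta>)
                   + 2 * (exp (2 * T * \<alpha> \<delta>) / lam (N \<delta>) powr (2 * \<gamma>))
                       * enn2real (Hp_norm_sq \<Omega> lam \<phi> (2 * \<gamma>) g)
                   + A * exp (- 2 * r * \<alpha> \<delta>))
                + A * \<bar>\<alpha> \<delta>\<bar> powr p * exp (- 2 * (t + r) * \<alpha> \<delta>)))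
         in (\<forall>\<^sub>F \<delta> in at_right 0. \<forall>t\<in>{0..T}. estimate \<delta> t) \<and>
            (\<forall>\<delta>>0. \<forall>t\<in>{0..T}. p \<le> 2 * (t + r) * \<alpha> \<delta> \<longrightarrow> estimate \<delta> t)"
proof -
  let ?S = "\<lambda>\<delta> t. 2 * \<delta>\<^sup>2 * real (N \<delta>) * exp (2 * T * \<alpha> \<delta>)
    + 2 * (exp (2 * T * \<alpha> \<delta>) / lam (N \<delta>) powr (2 * \<gamma>)) * enn2real (Hp_norm_sq \<Omega> lam \<phi> (2 * \<gamma>) g)
    + A * exp (- 2 * r * \<alpha> \<delta>)"
  let ?C = "\<lambda>\<delta> t. exp (2 * k\<^sup>2 * T * (T - t)) * exp (- 2 * t * \<alpha> \<delta>) * \<bar>\<alpha> \<delta>\<bar> powr p"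
  let ?D = "\<lambda>\<delta> t. A * \<bar>\<alpha> \<delta>\<bar> powr p * exp (- 2 * (t + r) * \<alpha> \<delta>)"
  \<comment> \<open>For negative \<open>A\<close> the strict decay bound at time 0 would read as a
    value below \<open>ennreal A = 0\<close>.\<close>
  have A: "0 \<le> A"
  proof (rule ccontr)
    assume "\<not> 0 \<le> A"
    then have zero: "ennreal A = 0" by (simp add: ennreal_neg)
    have "0 \<in> {0..T}" using \<open>T > 0\<close> by simp
    from assms(14)[OF this] show False unfolding zero by (rule not_less_zero[THEN notE])
  qed
  have est: "(\<integral>\<^sup>+\<omega>. Hp_norm_sq \<Omega> lam \<phi> p (\<lambda>x. u\<delta> \<delta> \<omega> t x - u t x) \<partial>M)
      \<le> ennreal (2 * exp (2 * k\<^sup>2 * T * (T - t)) * exp (- 2 * t * \<alpha> \<delta>) * \<bar>\<alpha> \<delta>\<bar> powr p * ?S \<delta> t + ?D \<delta> t)"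
    if \<delta>: "\<delta> > 0" and t: "t \<in> {0..T}" and p: "p \<le> 2 * (t + r) * \<alpha> \<delta>" for \<delta> t
  proof -
    have "(\<integral>\<^sup>+\<omega>. Hp_norm_sq \<Omega> lam \<phi> p (\<lambda>x. u\<delta> \<delta> \<omega> t x - u t x) \<partial>M)
        \<le> ennreal (?C \<delta> t * ?S \<delta> t + ?D \<delta> t)"
      unfolding abs_of_pos[OF assms(16)[OF \<delta>]]
    proof (rule regularized_error_expectation[where F = F and T = T,
          OF assms(5,6,11,9,12) _ _ A _ assms(15,16)[OF \<delta>] _ t p])
      show "mild_solution \<Omega> lam \<phi> T F g u"
        using assms(13) by (simp add: unique_solution_def)
      show "AE \<omega> in M. regularized_mild_solution \<Omega> lam \<phi> T F (\<alpha> \<delta>)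
          (observed_data \<Omega> \<phi> \<xi> g \<delta> (N \<delta>) \<omega>) (u\<delta> \<delta> \<omega>)"
        using assms(21)[OF \<delta>] by eventually_elim (simp add: unique_solution_def)
    qed (use assms(8,10) assms(14) in \<open>auto intro: less_imp_le\<close>)
    \<comment> \<open>The stated constant leaves room for a factor 2, harmless because the main term
      is nonnegative.\<close>
    also have "?C \<delta> t * ?S \<delta> t \<le> 2 * (?C \<delta> t * ?S \<delta> t)"
    proof -
      have "0 \<le> ?C \<delta> t * ?S \<delta> t"
        using A by (intro mult_nonneg_nonneg add_nonneg_nonneg divide_nonneg_nonneg) auto
      then show ?thesis by linarith
    qed
    finally show ?thesis by (simp add: ennreal_leI mult.assoc)
  qed
  \<comment> \<open>The threshold \<open>p / (2 * r)\<close> is the one for \<open>t = 0\<close>,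
    the worst case, so it serves every \<open>t\<close> in \<open>{0..T}\<close>.\<close>
  have "\<forall>\<^sub>F \<delta> in at_right 0. p / (2 * r) \<le> \<alpha> \<delta>"
    using assms(18) by (simp add: filterlim_at_top)
  moreover have "\<forall>\<^sub>F \<delta> in at_right (0::real). 0 < \<delta>"
    by (simp add: eventually_at_right_less)
  ultimately have "\<forall>\<^sub>F \<delta> in at_right 0. 0 < \<delta> \<and> (\<forall>t\<in>{0..T}. p \<le> 2 * (t + r) * \<alpha> \<delta>)"
  proof eventually_elim
    case (elim \<delta>)
    have "p \<le> 2 * (t + r) * \<alpha> \<delta>" if "t \<in> {0..T}" for t
    proof -
      have "p \<le> 2 * r * \<alpha> \<delta>" using elim(1) \<open>r > 0\<close> by (simp add: field_simps)
      also have "\<dots> \<le> 2 * (t + r) * \<alpha> \<delta>"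
        using that assms(16)[OF elim(2)] by (intro mult_right_mono) auto
      finally show ?thesis .
    qed
    then show ?case using elim(2) by blast
  qed
  then show ?thesis
    unfolding Let_def using est by (auto elim!: eventually_mono)
qed

end
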